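(* For all integers $m\ge 0$ and $\lambda\in\mathbb Z$, the following identities hold in $\dot{\mathbf U}$: \[ t_{\mathrm{odd}}^{(2m)}\mathbf 1_{2\lambda-1} = \sum_{c=0}^m \sum_{a=0}^{2m-2c} q^{2(a+c)(m-a-\lambda)-2ac +a-\binom{2c}{2}} \begin{bmatrix} m-c-a-\lambda+1\\ c\end{bmatrix}_{q^2} E^{(a)} F^{(2m-2c-a)}\mathbf 1_{2\lambda-1} \] \[ \qquad + \sum_{c=0}^{m-1} \sum_{a=0}^{2m-1-2c} q^{2(a+c+1)(m-a-\lambda) -2ac-\binom{2c+2}{2}+1} \begin{bmatrix} m-c-a-\lambda\\ c\end{bmatrix}_{q^2} E^{(a)} F^{(2m-1-2c-a)}\mathbf 1_{2\lambda-1}, \] \[ t_{\mathrm{odd}}^{(2m+1)}\mathbf 1_{2\lambda-1} = \sum_{c=0}^{m} \sum_{a=0}^{2m+1-2c} q^{2(a+c)(m-a-\lambda)-2ac+2a-\binom{2c-1}{2}+1} \begin{bmatrix} m-c-a-\lambda+1\\ c\end{bmatrix}_{q^2} E^{(a)} F^{(2m+1-2c-a)}\mathbf 1_{2\lambda-1} \] \[ \qquad +\sum_{c=0}^m \sum_{a=0}^{2m-2c} q^{2(a+c+1)(m-a-\lambda)-2ac+a-\binom{2c+1}{2}+1} \begin{bmatrix} m-c-a-\lambda\\ c\end{bmatrix}_{q^2} E^{(a)} F^{(2m-2c-a)}\mathbf 1_{2\lambda-1}. \] In particular, $t_{\mathrm{odd}}^{(n)}\mathbf 1_{2\lambda-1}\in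 {}_{\mathcal A}\dot{\mathbf U}_{\mathrm{odd}}$ for all $n\in\mathbb N$, $\lambda\in\mathbb Z$.
   Context: $\mathbb N=\{0,1,2,\dots\}$, $\mathcal A=\mathbb Z[q,q^{-1}]$. $\mathbf U=\mathbf U_q(\mathfrak{sl}_2)$ is the $\mathbb Q(q)$-algebra generated by $E,F,K,K^{-1}$ with relations $KK^{-1}=K^{-1}K=1$, $EF-FE=\frac{K-K^{-1}}{q-q^{-1}}$, $KE=q^2EK$, $KF=q^{-2}FK$. For $n\in\mathbb Z$, $[n]=\frac{q^n-q^{-n}}{q-q^{-1}}$, $[n]!=[1]\cdots[n]$ for $n\ge 0$; $E^{(n)}=E^n/[n]!$, $F^{(n)}=F^n/[n]!$. For $m\in\mathbb Z$, $b\in\mathbb N$, $\begin{bmatrix} m\\ b\end{bmatrix}_{q^2}=\prod_{1\le i\le b}\frac{q^{2(m-i+1)}-q^{-2(m-i+1)}}{q^{2i}-q^{-2i}}$. In exponents, $\binom{x}{2}=x(x-1)/2$ for all integers $x$ (in particular $\binom{-1}{2}=1$). Empty sums are $0$. Put $\check E=q^{-1}EK^{-1}$ and $t=\check E+F+K^{-1}$. The $\imath$-divided powers $t_{\mathrm{odd}}^{(n)}$ are the polynomials in $t$ determined by $t_{\mathrm{odd}}^{(0)}=1$, $t_{\mathrm{odd}}^{(1)}=t$, and, for $a\ge 1$: $t\cdot t_{\mathrm{odd}}^{(2a-1)}=[2a]\,t_{\mathrm{odd}}^{(2a)}$, $t\cdot t_{\mathrm{odd}}^{(2a)}=[2a+1]\,t_{\mathrm{odd}}^{(2a+1)}+[2a]\,t_{\mathrm{odd}}^{(2a-1)}$.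 $\dot{\mathbf U}$ is the modified quantum group: the $\mathbb Q(q)$-algebra generated by $E\mathbf 1_\lambda$, $F\mathbf 1_\lambda$ and idempotents $\mathbf 1_\lambda$ ($\lambda\in\mathbb Z$) with relations $\mathbf 1_\lambda\mathbf 1_\mu=\delta_{\lambda,\mu}\mathbf 1_\lambda$, $E\mathbf 1_\lambda=\mathbf 1_{\lambda+2}E\mathbf 1_\lambda=\mathbf 1_{\lambda+2}E$, $F\mathbf 1_\lambda=\mathbf 1_{\lambda-2}F\mathbf 1_\lambda=\mathbf 1_{\lambda-2}F$, $EF\mathbf 1_\lambda-FE\mathbf 1_\lambda=[\lambda]\mathbf 1_\lambda$. $\mathbf U$ acts naturally on $\dot{\mathbf U}$ from the left, with $K\mathbf 1_\lambda=q^\lambda\mathbf 1_\lambda$. ${}_{\mathcal A}\dot{\mathbf U}$ is the $\mathcal A$-subalgebra of $\dot{\mathbf U}$ generated by $E^{(n)}\mathbf 1_\lambda$, $F^{(n)}\mathbf 1_\lambda$, $\mathbf 1_\lambda$ ($n\ge 0$, $\lambda\in\mathbb Z$), and ${}_{\mathcal A}\dot{\mathbf U}_{\mathrm{odd}}=\bigoplus_{\lambda\in\mathbb Z}{}_{\mathcal A}\dot{\mathbf U}\,\mathbf 1_{2\lambda-1}$. *)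

theory Defs
  imports
    Complex_Main
    "HOL-Computational_Algebra.Fraction_Field"
    "HOL-Computational_Algebra.Polynomial"
    "HOL-Library.Groups_Big_Fun"
begin

section \<open>The ground field and quantum integers\<close>

type_synonym Qq = "rat poly fract"

definition q :: Qq where
  "q = Fraction_Field.Fract (monom 1 1) 1"

definition qint :: "int \<Rightarrow> Qq" where
  "qint n = (q powi n - q powi (- n)) / (q - inverse q)"

definition qfact :: "nat \<Rightarrow> Qq" where
  "qfact n = (\<Prod>i=1..n. qint (int i))"

text \<open>The binomial coefficient in the variable \<open>q\<^sup>2\<close>, with integral upper entry.\<close>
definition qbinom2 :: "int \<Rightarrow> nat \<Rightarrow> Qq" where
  "qbinom2 m b = (\<Prod>i=1..b.
     (q powi (2 * (m - int i + 1)) - q powi (- 2 * (m - int i + 1))) /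
     (q powi (2 * int i) - q powi (- 2 * int i)))"

text \<open>\<open>x (x - 1) / 2\<close>, for negative \<open>x\<close> as well; the division is exact.\<close>
definition binom2 :: "int \<Rightarrow> int" where
  "binom2 x = x * (x - 1) div 2"

text \<open>The ring of integral Laurent polynomials in \<open>q\<close>.\<close>
definition Laurent :: "Qq set" where
  "Laurent = {(\<Sum>k\<in>S. of_int (f k) * q powi k) | S f. finite S}"

lemma q_power: "q ^ n = Fraction_Field.Fract (monom 1 n) 1"
  by (induction n) (simp_all add: q_def One_fract_def mult_monom)

lemma q_nonzero [simp]: "q \<noteq> 0"
  by (simp add: q_def Zero_fract_def eq_fract)

lemma q_power_neq_1: "n > 0 \<Longrightarrow> q ^ n \<noteq> 1"
  using monom_eq_iff'[of "1::rat" n 1 0]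
  by (simp add: q_power One_fract_def eq_fract flip: monom_eq_1)

lemma q_powi_neq_1: "n \<noteq> 0 \<Longrightarrow> q powi n \<noteq> 1"
  using q_power_neq_1[of "nat n"] q_power_neq_1[of "nat (- n)"]
  by (auto simp: power_int_def field_simps)

lemma q_powi_diff_nonzero: "n \<noteq> 0 \<Longrightarrow> q powi n - q powi (- n) \<noteq> 0"
proof
  assume n: "n \<noteq> 0" and "q powi n - q powi (- n) = 0"
  then have "q powi n = q powi (- n)" by simp
  then have "q powi n * q powi n = q powi (- n) * q powi n" by (rule arg_cong)
  then have "q powi (n + n) = q powi (- n + n)"
    by (simp only: power_int_add q_nonzero simp_thms)
  then have "q powi (2 * n) = 1"
    by (simp only: mult_2) simp
  with n q_powi_neq_1 [of "2 * n"] show False by simp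
qed

lemma qint_0 [simp]: "qint 0 = 0"
  by (simp add: qint_def)

lemma qint_nonzero: "n \<noteq> 0 \<Longrightarrow> qint n \<noteq> 0"
  using q_powi_diff_nonzero [of n] q_powi_diff_nonzero [of 1]
  by (simp add: qint_def power_int_minus)

lemma qfact_nonzero: "qfact n \<noteq> 0"
  by (simp add: qfact_def qint_nonzero)

class Qq_algebra = ring +
  fixes qscale :: "Qq \<Rightarrow> 'a \<Rightarrow> 'a"  (infixr \<open>*\<^sub>q\<close> 75)
  assumes qscale_add_right: "c *\<^sub>q (x + y) = c *\<^sub>q x + c *\<^sub>q y"
    and qscale_add_left: "(c + d) *\<^sub>q x = c *\<^sub>q x + d *\<^sub>q x"
    and qscale_qscale: "c *\<^sub>q (d *\<^sub>q x) = (c * d) *\<^sub>q x"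
    and qscale_one [simp]: "1 *\<^sub>q x = x"
    and mult_qscale_left: "(c *\<^sub>q x) * y = c *\<^sub>q (x * y)"
    and mult_qscale_right: "x * (c *\<^sub>q y) = c *\<^sub>q (x * y)"
begin

lemma qscale_0_right [simp]: "c *\<^sub>q 0 = 0"
  using qscale_add_right [of c 0 0] by simp

lemma qscale_0_left [simp]: "0 *\<^sub>q x = 0"
  using qscale_add_left [of 0 0 x] by simp

lemma qscale_minus_one: "(- 1) *\<^sub>q x = - x"
  using qscale_add_left [of 1 "- 1" x] by (simp add: eq_neg_iff_add_eq_0 add.commute)

end

section \<open>Algebras given by generators and relations\<close>

text \<open>
  Formal expressions over a set of generators, modulo the congruence generated by the laws of
  associative, not necessarily unital algebras and the given relations. The quotient is the free
  non-unital algebra modulo the two-sided ideal of the relations. A unital algebra has an extra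
  generator for the unit, subject to the unit laws.
\<close>

datatype 'g aterm =
  Gen 'g
| Zero
| Add "'g aterm" "'g aterm"
| Scale Qq "'g aterm"
| Mul "'g aterm" "'g aterm"

inductive alg_eq :: "('g aterm \<Rightarrow> 'g aterm \<Rightarrow> bool) \<Rightarrow> 'g aterm \<Rightarrow> 'g aterm \<Rightarrow> bool"
  for R where
  rel: "R x y \<Longrightarrow> alg_eq R x y"
| refl: "alg_eq R x x"
| sym: "alg_eq R x y \<Longrightarrow> alg_eq R y x"
| trans: "alg_eq R x y \<Longrightarrow> alg_eq R y z \<Longrightarrow> alg_eq R x z"
| Add_cong: "alg_eq R x x' \<Longrightarrow> alg_eq R y y' \<Longrightarrow> alg_eq R (Add x y) (Add x' y')"
| Scale_cong: "alg_eq R x x' \<Longrightarrow> alg_eq R (Scale c x) (Scale c x')"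
| Mul_cong: "alg_eq R x x' \<Longrightarrow> alg_eq R y y' \<Longrightarrow> alg_eq R (Mul x y) (Mul x' y')"
| Add_assoc: "alg_eq R (Add (Add x y) z) (Add x (Add y z))"
| Add_comm: "alg_eq R (Add x y) (Add y x)"
| Add_Zero: "alg_eq R (Add Zero x) x"
| Add_neg: "alg_eq R (Add (Scale (- 1) x) x) Zero"
| Scale_Add_right: "alg_eq R (Scale c (Add x y)) (Add (Scale c x) (Scale c y))"
| Scale_Add_left: "alg_eq R (Scale (c + d) x) (Add (Scale c x) (Scale d x))"
| Scale_Scale: "alg_eq R (Scale c (Scale d x)) (Scale (c * d) x)"
| Scale_one: "alg_eq R (Scale 1 x) x"
| Mul_assoc: "alg_eq R (Mul (Mul x y) z) (Mul x (Mul y z))"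
| Mul_Add_left: "alg_eq R (Mul (Add x y) z) (Add (Mul x z) (Mul y z))"
| Mul_Add_right: "alg_eq R (Mul x (Add y z)) (Add (Mul x y) (Mul x z))"
| Mul_Scale_left: "alg_eq R (Mul (Scale c x) y) (Scale c (Mul x y))"
| Mul_Scale_right: "alg_eq R (Mul x (Scale c y)) (Scale c (Mul x y))"

lemma equivp_alg_eq: "equivp (alg_eq R)"
  by (intro equivpI reflpI sympI transpI) (blast intro: alg_eq.intros)+

section \<open>The quantum group of \<open>sl\<^sub>2\<close>\<close>

datatype U_gen = gOne | gE | gF | gK | gKinv

abbreviation (input) Sub :: "'g aterm \<Rightarrow> 'g aterm \<Rightarrow> 'g aterm" where
  "Sub x y \<equiv> Add x (Scale (- 1) y)"

inductive U_rel :: "U_gen aterm \<Rightarrow> U_gen aterm \<Rightarrow> bool" where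
  "U_rel (Mul (Gen gOne) x) x"
| "U_rel (Mul x (Gen gOne)) x"
| "U_rel (Mul (Gen gK) (Gen gKinv)) (Gen gOne)"
| "U_rel (Mul (Gen gKinv) (Gen gK)) (Gen gOne)"
| "U_rel (Sub (Mul (Gen gE) (Gen gF)) (Mul (Gen gF) (Gen gE)))
     (Scale (inverse (q - inverse q)) (Sub (Gen gK) (Gen gKinv)))"
| "U_rel (Mul (Gen gK) (Gen gE)) (Scale (q\<^sup>2) (Mul (Gen gE) (Gen gK)))"
| "U_rel (Mul (Gen gK) (Gen gF)) (Scale (q powi (- 2)) (Mul (Gen gF) (Gen gK)))"

quotient_type U = "U_gen aterm" / "alg_eq U_rel"
  by (rule equivp_alg_eq)

text \<open>The counit; it is only used to see that \<open>0 \<noteq> 1\<close>.\<close>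
primrec counit_term :: "U_gen aterm \<Rightarrow> Qq" where
  "counit_term (Gen g) = (if g = gE \<or> g = gF then 0 else 1)"
| "counit_term Zero = 0"
| "counit_term (Add x y) = counit_term x + counit_term y"
| "counit_term (Scale c x) = c * counit_term x"
| "counit_term (Mul x y) = counit_term x * counit_term y"

lemma counit_term_cong: "alg_eq U_rel x y \<Longrightarrow> counit_term x = counit_term y"
  by (induction rule: alg_eq.induct) (auto elim!: U_rel.cases simp: algebra_simps)

instantiation U :: "{Qq_algebra, ring_1}"
begin

lift_definition zero_U :: U is Zero .
lift_definition one_U :: U is "Gen gOne" .
lift_definition plus_U :: "U \<Rightarrow> U \<Rightarrow> U" is Add by (rule alg_eq.Add_cong)
lift_definition uminus_U :: "U \<Rightarrow> U" is "Scale (- 1)" by (rule alg_eq.Scale_cong)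
lift_definition minus_U :: "U \<Rightarrow> U \<Rightarrow> U" is Sub
  by (intro alg_eq.Add_cong alg_eq.Scale_cong)
lift_definition times_U :: "U \<Rightarrow> U \<Rightarrow> U" is Mul by (rule alg_eq.Mul_cong)
lift_definition qscale_U :: "Qq \<Rightarrow> U \<Rightarrow> U" is Scale by (rule alg_eq.Scale_cong)

instance
proof
  show "(0::U) \<noteq> 1"
    by transfer (auto dest: counit_term_cong)
qed (transfer; blast intro: alg_eq.intros U_rel.intros)+

end

lift_definition U_E :: U is "Gen gE" .
lift_definition U_F :: U is "Gen gF" .
lift_definition U_K :: U is "Gen gK" .
lift_definition U_Kinv :: U is "Gen gKinv" .

lemma U_relations:
  "U_K * U_Kinv = 1"
  "U_Kinv * U_K = 1"
  "U_E * U_F - U_F * U_E = inverse (q - inverse q) *\<^sub>q (U_K - U_Kinv)"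
  "U_K * U_E = q\<^sup>2 *\<^sub>q (U_E * U_K)"
  "U_K * U_F = q powi (- 2) *\<^sub>q (U_F * U_K)"
  by (transfer, rule alg_eq.rel, rule U_rel.intros)+

definition divE :: "nat \<Rightarrow> U" where
  "divE n = inverse (qfact n) *\<^sub>q U_E ^ n"

definition divF :: "nat \<Rightarrow> U" where
  "divF n = inverse (qfact n) *\<^sub>q U_F ^ n"

definition Echeck :: U where
  "Echeck = inverse q *\<^sub>q (U_E * U_Kinv)"

definition t :: U where
  "t = Echeck + U_F + U_Kinv"

text \<open>
  The defining recurrences, solved for the highest divided power; they are recovered in
  \<open>t_odd_even_step\<close> and \<open>t_odd_odd_step\<close>.
\<close>
fun t_odd :: "nat \<Rightarrow> U" where
  "t_odd 0 = 1"
| "t_odd (Suc 0) = t"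
| "t_odd (Suc (Suc n)) = inverse (qint (int n + 2)) *\<^sub>q
     (if even n then t * t_odd (Suc n)
      else t * t_odd (Suc n) - qint (int n + 1) *\<^sub>q t_odd n)"

lemma t_odd_even_step:
  assumes "a \<ge> 1"
  shows "t * t_odd (2 * a - 1) = qint (2 * int a) *\<^sub>q t_odd (2 * a)"
proof -
  obtain b where "a = Suc b" using assms by (cases a) auto
  then show ?thesis
    by (simp add: qscale_qscale qint_nonzero add.commute)
qed

lemma t_odd_odd_step:
  assumes "a \<ge> 1"
  shows "t * t_odd (2 * a) =
    qint (2 * int a + 1) *\<^sub>q t_odd (2 * a + 1) + qint (2 * int a) *\<^sub>q t_odd (2 * a - 1)"
proof -
  obtain b where b: "a = Suc b" using assms by (cases a) auto
  have "t_odd (2 * a + 1) = inverse (qint (2 * int a + 1)) *\<^sub>q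
      (t * t_odd (2 * a) - qint (2 * int a) *\<^sub>q t_odd (2 * a - 1))"
    using t_odd.simps(3) [of "Suc (2 * b)"] by (simp add: b del: t_odd.simps)
  then show ?thesis
    by (simp add: qscale_qscale qint_nonzero)
qed

section \<open>The modified quantum group\<close>

text \<open>\<open>gE1 l\<close>, \<open>gF1 l\<close> and \<open>gId l\<close> are the generators \<open>E 1\<^sub>l\<close>, \<open>F 1\<^sub>l\<close> and \<open>1\<^sub>l\<close>.\<close>
datatype Udot_gen = gE1 int | gF1 int | gId int

text \<open>
  In the relation \<open>E 1\<^sub>l = 1\<^sub>l\<^sub>+\<^sub>2 E 1\<^sub>l = 1\<^sub>l\<^sub>+\<^sub>2 E\<close>, the symbol \<open>E 1\<^sub>l\<close> stands for a generator which is
  fixed by \<open>1\<^sub>l\<close> on the right and by \<open>1\<^sub>l\<^sub>+\<^sub>2\<close> on the left; similarly for \<open>F\<close>. The product \<open>E F 1\<^sub>l\<close> is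
  \<open>(E 1\<^sub>l\<^sub>-\<^sub>2) (F 1\<^sub>l)\<close>, and \<open>F E 1\<^sub>l\<close> is \<open>(F 1\<^sub>l\<^sub>+\<^sub>2) (E 1\<^sub>l)\<close>.
\<close>
inductive Udot_rel :: "Udot_gen aterm \<Rightarrow> Udot_gen aterm \<Rightarrow> bool" where
  "Udot_rel (Mul (Gen (gId l)) (Gen (gId l))) (Gen (gId l))"
| "l \<noteq> m \<Longrightarrow> Udot_rel (Mul (Gen (gId l)) (Gen (gId m))) Zero"
| "Udot_rel (Mul (Gen (gId (l + 2))) (Gen (gE1 l))) (Gen (gE1 l))"
| "Udot_rel (Mul (Gen (gE1 l)) (Gen (gId l))) (Gen (gE1 l))"
| "Udot_rel (Mul (Gen (gId (l - 2))) (Gen (gF1 l))) (Gen (gF1 l))"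
| "Udot_rel (Mul (Gen (gF1 l)) (Gen (gId l))) (Gen (gF1 l))"
| "Udot_rel
     (Sub (Mul (Gen (gE1 (l - 2))) (Gen (gF1 l))) (Mul (Gen (gF1 (l + 2))) (Gen (gE1 l))))
     (Scale (qint l) (Gen (gId l)))"

quotient_type Udot = "Udot_gen aterm" / "alg_eq Udot_rel"
  by (rule equivp_alg_eq)

instantiation Udot :: Qq_algebra
begin

lift_definition zero_Udot :: Udot is Zero .
lift_definition plus_Udot :: "Udot \<Rightarrow> Udot \<Rightarrow> Udot" is Add by (rule alg_eq.Add_cong)
lift_definition uminus_Udot :: "Udot \<Rightarrow> Udot" is "Scale (- 1)" by (rule alg_eq.Scale_cong)
lift_definition minus_Udot :: "Udot \<Rightarrow> Udot \<Rightarrow> Udot" is Sub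
  by (intro alg_eq.Add_cong alg_eq.Scale_cong)
lift_definition times_Udot :: "Udot \<Rightarrow> Udot \<Rightarrow> Udot" is Mul by (rule alg_eq.Mul_cong)
lift_definition qscale_Udot :: "Qq \<Rightarrow> Udot \<Rightarrow> Udot" is Scale by (rule alg_eq.Scale_cong)

instance
  by standard (transfer; blast intro: alg_eq.intros)+

end

lift_definition E1 :: "int \<Rightarrow> Udot" is "\<lambda>l. Gen (gE1 l)" .
lift_definition F1 :: "int \<Rightarrow> Udot" is "\<lambda>l. Gen (gF1 l)" .
lift_definition idem :: "int \<Rightarrow> Udot" is "\<lambda>l. Gen (gId l)" .

lemma idem_same [simp]: "idem l * idem l = idem l"
  and idem_other: "l \<noteq> m \<Longrightarrow> idem l * idem m = 0"
  and idem_E1 [simp]: "idem (l + 2) * E1 l = E1 l"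
  and E1_idem [simp]: "E1 l * idem l = E1 l"
  and idem_F1 [simp]: "idem (l - 2) * F1 l = F1 l"
  and F1_idem [simp]: "F1 l * idem l = F1 l"
  and E1_F1: "E1 (l - 2) * F1 l - F1 (l + 2) * E1 l = qint l *\<^sub>q idem l"
  by (transfer, rule alg_eq.rel, rule Udot_rel.intros, assumption?)+

lemma idem_mult_idem: "idem l * idem m = (if l = m then idem l else 0)"
  by (simp add: idem_other)

lemma idem_mult_E1: "idem l * E1 m = (if l = m + 2 then E1 m else 0)"
proof -
  have "idem l * E1 m = idem l * idem (m + 2) * E1 m" by (simp add: mult.assoc)
  then show ?thesis by (simp only: idem_mult_idem) simp
qed

lemma idem_mult_F1: "idem l * F1 m = (if l = m - 2 then F1 m else 0)"
proof -
  have "idem l * F1 m = idem l * idem (m - 2) * F1 m" by (simp add: mult.assoc)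
  then show ?thesis by (simp only: idem_mult_idem) simp
qed

lemma E1_mult_idem: "E1 l * idem m = (if l = m then E1 l else 0)"
proof -
  have "E1 l * idem m = E1 l * (idem l * idem m)" by (simp flip: mult.assoc)
  then show ?thesis by (simp only: idem_mult_idem) simp
qed

lemma F1_mult_idem: "F1 l * idem m = (if l = m then F1 l else 0)"
proof -
  have "F1 l * idem m = F1 l * (idem l * idem m)" by (simp flip: mult.assoc)
  then show ?thesis by (simp only: idem_mult_idem) simp
qed

lemma Udot_induct [case_names E1 F1 idem zero add qscale mult]:
  assumes "\<And>l. P (E1 l)" "\<And>l. P (F1 l)" "\<And>l. P (idem l)" "P 0"
    and "\<And>x y. P x \<Longrightarrow> P y \<Longrightarrow> P (x + y)"
    and "\<And>c x. P x \<Longrightarrow> P (c *\<^sub>q x)"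
    and "\<And>x y. P x \<Longrightarrow> P y \<Longrightarrow> P (x * y)"
  shows "P x"
proof -
  have "P (abs_Udot s)" for s
  proof (induction s)
    case (Gen g)
    then show ?case
      using assms(1-3) by (cases g) (simp_all add: E1_def F1_def idem_def)
  qed (use assms(4-7) in
      \<open>simp_all flip: zero_Udot_def plus_Udot.abs_eq qscale_Udot.abs_eq times_Udot.abs_eq\<close>)
  from this [of "rep_Udot x"] show ?thesis
    by (simp add: Quotient3_abs_rep [OF Quotient3_Udot])
qed

lemma finite_weights: "finite {l. idem l * x \<noteq> 0}"
proof (induction x rule: Udot_induct)
  case (add x y)
  then have "finite ({l. idem l * x \<noteq> 0} \<union> {l. idem l * y \<noteq> 0})" by simp
  then show ?case
    by (rule rev_finite_subset) (auto simp: distrib_left)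
next
  case (qscale c x)
  then show ?case
    by (rule rev_finite_subset) (auto simp: mult_qscale_right)
next
  case (mult x y)
  from mult(1) show ?case
    by (rule rev_finite_subset) (auto simp flip: mult.assoc)
qed (auto simp: idem_mult_E1 idem_mult_F1 idem_mult_idem)

section \<open>The left action\<close>

text \<open>
  Only finitely many summands of \<open>wsum f x\<close> are nonzero if \<open>f l * idem l = f l\<close> for all \<open>l\<close>.
\<close>
definition wsum :: "(int \<Rightarrow> Udot) \<Rightarrow> Udot \<Rightarrow> Udot" where
  "wsum f x = Sum_any (\<lambda>l. f l * x)"

lemma finite_wsum:
  assumes "\<And>l. f l * idem l = f l"
  shows "finite {l. f l * x \<noteq> 0}"
  using finite_weights [of x]
proof (rule rev_finite_subset)
  have "f l * x = f l * (idem l * x)" for l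
    by (simp add: assms flip: mult.assoc)
  then show "{l. f l * x \<noteq> 0} \<subseteq> {l. idem l * x \<noteq> 0}" by auto
qed

lemma wsum_add:
  assumes "\<And>l. f l * idem l = f l"
  shows "wsum f (x + y) = wsum f x + wsum f y"
  unfolding wsum_def distrib_left
  by (rule Sum_any.distrib) (rule finite_wsum [OF assms])+

lemma wsum_zero [simp]: "wsum f 0 = 0"
  by (simp add: wsum_def)

lemma Sum_any_hom:
  fixes f :: "int \<Rightarrow> Udot"
  assumes "finite {l. f l \<noteq> 0}" and "h 0 = (0 :: Udot)" and "\<And>x y. h (x + y) = h x + h y"
  shows "Sum_any (\<lambda>l. h (f l)) = h (Sum_any f)"
proof -
  have "Sum_any (\<lambda>l. h (f l)) = (\<Sum>l | f l \<noteq> 0. h (f l))"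
    using assms by (intro Sum_any.expand_superset) auto
  also have "\<dots> = h (\<Sum>l | f l \<noteq> 0. f l)"
    using assms(1) by (induction rule: finite_induct) (simp_all add: assms)
  also have "\<dots> = h (Sum_any f)"
    by (simp add: Sum_any.expand_set)
  finally show ?thesis .
qed

lemma wsum_qscale:
  assumes "\<And>l. f l * idem l = f l"
  shows "wsum f (c *\<^sub>q x) = c *\<^sub>q wsum f x"
  unfolding wsum_def mult_qscale_right
  by (rule Sum_any_hom [where h = "qscale c"])
    (simp_all add: finite_wsum [OF assms] qscale_add_right)

lemma wsum_mult:
  assumes "\<And>l. f l * idem l = f l"
  shows "wsum f (x * y) = wsum f x * y"
  unfolding wsum_def mult.assoc [symmetric]
  by (rule Sum_any_hom [where h = "\<lambda>z. z * y"])
    (simp_all add: finite_wsum [OF assms] distrib_right)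

lemma wsum_fun_add:
  assumes "\<And>l. f l * idem l = f l" "\<And>l. g l * idem l = g l"
  shows "wsum (\<lambda>l. f l + g l) x = wsum f x + wsum g x"
  unfolding wsum_def distrib_right
  by (rule Sum_any.distrib) (rule finite_wsum, rule assms)+

lemma wsum_fun_qscale:
  assumes "\<And>l. f l * idem l = f l"
  shows "wsum (\<lambda>l. c *\<^sub>q f l) x = c *\<^sub>q wsum f x"
  unfolding wsum_def mult_qscale_left
  by (rule Sum_any_hom [where h = "qscale c"])
    (simp_all add: finite_wsum [OF assms] qscale_add_right)

lemma wsum_weight:
  assumes f: "\<And>l. f l * idem l = f l"
    and y: "idem s * y = y"
  shows "wsum f y = f s * y"
proof -
  have "f l * y = (if l = s then f s * y else 0)" for l
  proof -
    have "f l * y = (f l * idem l) * (idem s * y)"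
      by (simp only: f y)
    also have "\<dots> = f l * (idem l * idem s) * y"
      by (simp only: mult.assoc)
    also have "\<dots> = (if l = s then f s * y else 0)"
      by (simp add: idem_mult_idem f)
    finally show ?thesis .
  qed
  then have "(\<lambda>l. f l * y) = (\<lambda>l. if l = s then f s * y else 0)"
    by (rule ext)
  then show ?thesis
    by (simp only: wsum_def) simp
qed

lemma wsum_wsum:
  assumes f: "\<And>l. f l * idem l = f l"
    and g: "\<And>l. g l * idem l = g l"
    and s: "\<And>l. idem (s l) * g l = g l"
  shows "wsum f (wsum g x) = wsum (\<lambda>l. f (s l) * g l) x"
proof -
  have "wsum f (g l * x) = f (s l) * (g l * x)" for l
    by (rule wsum_weight [OF f]) (simp add: s flip: mult.assoc)
  then have "wsum (\<lambda>l. f (s l) * g l) x = Sum_any (\<lambda>l. wsum f (g l * x))"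
    by (simp add: wsum_def mult.assoc)
  also have "\<dots> = wsum f (wsum g x)"
    unfolding wsum_def [of g]
    by (rule Sum_any_hom [where h = "wsum f"]) (simp_all add: finite_wsum [OF g] wsum_add [OF f])
  finally show ?thesis ..
qed

lemma wsum_idem: "wsum idem x = x"
proof (induction x rule: Udot_induct)
  case (E1 l)
  then show ?case by (subst wsum_weight [where s = "l + 2"]) simp_all
next
  case (F1 l)
  then show ?case by (subst wsum_weight [where s = "l - 2"]) simp_all
next
  case (idem l)
  then show ?case by (subst wsum_weight [where s = l]) simp_all
next
  case zero
  show ?case by (rule wsum_zero)
next
  case (add x y)
  have "wsum idem (x + y) = wsum idem x + wsum idem y" by (rule wsum_add) (rule idem_same)
  then show ?case by (simp only: add)
next
  case (qscale c x)
  have "wsum idem (c *\<^sub>q x) = c *\<^sub>q wsum idem x" by (rule wsum_qscale) (rule idem_same)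
  then show ?case by (simp only: qscale)
next
  case (mult x y)
  have "wsum idem (x * y) = wsum idem x * y" by (rule wsum_mult) (rule idem_same)
  then show ?case by (simp only: mult)
qed

text \<open>
  The generators act through \<open>E x = (\<Sum>l. E 1\<^sub>l x)\<close>, \<open>F x = (\<Sum>l. F 1\<^sub>l x)\<close> and
  \<open>K x = (\<Sum>l. q\<^sup>l 1\<^sub>l x)\<close>.
\<close>
primrec act_term :: "U_gen aterm \<Rightarrow> Udot \<Rightarrow> Udot" where
  "act_term (Gen g) x = (case g of
     gOne \<Rightarrow> x
   | gE \<Rightarrow> wsum E1 x
   | gF \<Rightarrow> wsum F1 x
   | gK \<Rightarrow> wsum (\<lambda>l. q powi l *\<^sub>q idem l) x
   | gKinv \<Rightarrow> wsum (\<lambda>l. q powi (- l) *\<^sub>q idem l) x)"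
| "act_term Zero x = 0"
| "act_term (Add u v) x = act_term u x + act_term v x"
| "act_term (Scale c u) x = c *\<^sub>q act_term u x"
| "act_term (Mul u v) x = act_term u (act_term v x)"

lemma act_term_add: "act_term u (x + y) = act_term u x + act_term u y"
  by (induction u arbitrary: x y)
    (simp_all add: wsum_add mult_qscale_left qscale_add_right split: U_gen.split)

lemma act_term_qscale: "act_term u (c *\<^sub>q x) = c *\<^sub>q act_term u x"
  by (induction u arbitrary: x)
    (simp_all add: wsum_qscale mult_qscale_left qscale_add_right qscale_qscale mult.commute
      split: U_gen.split)

lemma act_term_mult: "act_term u (x * y) = act_term u x * y"
  by (induction u arbitrary: x)
    (simp_all add: wsum_mult mult_qscale_left distrib_right split: U_gen.split)

lemma act_term_U_rel: "U_rel u v \<Longrightarrow> act_term u x = act_term v x"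
proof (induction rule: U_rel.induct)
  case 3
  have "wsum (\<lambda>l. q powi l *\<^sub>q idem l) (wsum (\<lambda>l. q powi (- l) *\<^sub>q idem l) x) = wsum idem x"
    by (subst wsum_wsum [where s = "\<lambda>l. l"])
      (simp_all add: mult_qscale_left mult_qscale_right qscale_qscale power_int_minus)
  then show ?case by (simp add: wsum_idem)
next
  case 4
  have "wsum (\<lambda>l. q powi (- l) *\<^sub>q idem l) (wsum (\<lambda>l. q powi l *\<^sub>q idem l) x) = wsum idem x"
    by (subst wsum_wsum [where s = "\<lambda>l. l"])
      (simp_all add: mult_qscale_left mult_qscale_right qscale_qscale power_int_minus)
  then show ?case by (simp add: wsum_idem)
next
  case 5
  have EF: "wsum E1 (wsum F1 x) = wsum (\<lambda>l. E1 (l - 2) * F1 l) x"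
    by (rule wsum_wsum) simp_all
  have FE: "wsum F1 (wsum E1 x) = wsum (\<lambda>l. F1 (l + 2) * E1 l) x"
    by (rule wsum_wsum) simp_all
  have "wsum E1 (wsum F1 x) + (- 1) *\<^sub>q wsum F1 (wsum E1 x) =
      wsum (\<lambda>l. E1 (l - 2) * F1 l + (- 1) *\<^sub>q (F1 (l + 2) * E1 l)) x"
    unfolding EF FE
    by (subst wsum_fun_add, simp_all add: mult.assoc mult_qscale_left,
        subst wsum_fun_qscale, simp_all add: mult.assoc)
  also have "\<dots> = wsum (\<lambda>l. inverse (q - inverse q) *\<^sub>q
      (q powi l *\<^sub>q idem l + (- 1) *\<^sub>q (q powi (- l) *\<^sub>q idem l))) x"
  proof -
    have "E1 (l - 2) * F1 l + (- 1) *\<^sub>q (F1 (l + 2) * E1 l) = qint l *\<^sub>q idem l" for l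
      using E1_F1 [of l] by (simp add: qscale_minus_one)
    moreover have "inverse (q - inverse q) *\<^sub>q
        (q powi l *\<^sub>q idem l + (- 1) *\<^sub>q (q powi (- l) *\<^sub>q idem l)) = qint l *\<^sub>q idem l" for l
      by (simp add: qscale_qscale qint_def divide_inverse mult.commute flip: qscale_add_left)
    ultimately show ?thesis by simp
  qed
  also have "\<dots> = inverse (q - inverse q) *\<^sub>q
      (wsum (\<lambda>l. q powi l *\<^sub>q idem l) x + (- 1) *\<^sub>q wsum (\<lambda>l. q powi (- l) *\<^sub>q idem l) x)"
    by (simp add: wsum_fun_qscale wsum_fun_add mult_qscale_left distrib_right)
  finally show ?case by simp
next
  case 6
  have "wsum (\<lambda>l. q powi l *\<^sub>q idem l) (wsum E1 x) = wsum (\<lambda>l. q powi (l + 2) *\<^sub>q E1 l) x"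
    by (subst wsum_wsum [where s = "\<lambda>l. l + 2"]) (simp_all add: mult_qscale_left)
  also have "\<dots> = wsum (\<lambda>l. q\<^sup>2 *\<^sub>q (q powi l *\<^sub>q E1 l)) x"
    by (simp add: qscale_qscale power_int_add mult.commute)
  also have "\<dots> = q\<^sup>2 *\<^sub>q wsum (\<lambda>l. q powi l *\<^sub>q E1 l) x"
    by (rule wsum_fun_qscale) (simp add: mult_qscale_left)
  also have "wsum (\<lambda>l. q powi l *\<^sub>q E1 l) x = wsum E1 (wsum (\<lambda>l. q powi l *\<^sub>q idem l) x)"
    by (subst wsum_wsum [where s = "\<lambda>l. l"]) (simp_all add: mult_qscale_left mult_qscale_right)
  finally show ?case by simp
next
  case 7
  have "wsum (\<lambda>l. q powi l *\<^sub>q idem l) (wsum F1 x) = wsum (\<lambda>l. q powi (l - 2) *\<^sub>q F1 l) x"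
    by (subst wsum_wsum [where s = "\<lambda>l. l - 2"]) (simp_all add: mult_qscale_left)
  also have "\<dots> = wsum (\<lambda>l. q powi (- 2) *\<^sub>q (q powi l *\<^sub>q F1 l)) x"
    by (simp add: qscale_qscale flip: power_int_add)
  also have "\<dots> = q powi (- 2) *\<^sub>q wsum (\<lambda>l. q powi l *\<^sub>q F1 l) x"
    by (rule wsum_fun_qscale) (simp add: mult_qscale_left)
  also have "wsum (\<lambda>l. q powi l *\<^sub>q F1 l) x = wsum F1 (wsum (\<lambda>l. q powi l *\<^sub>q idem l) x)"
    by (subst wsum_wsum [where s = "\<lambda>l. l"]) (simp_all add: mult_qscale_left mult_qscale_right)
  finally show ?case by simp
qed simp_all

lemma act_term_cong: "alg_eq U_rel u v \<Longrightarrow> act_term u x = act_term v x"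
proof (induction arbitrary: x rule: alg_eq.induct)
  case (rel u v)
  then show ?case by (rule act_term_U_rel)
qed (simp_all add: act_term_add act_term_qscale qscale_add_left qscale_add_right qscale_qscale
    qscale_minus_one add.assoc add.commute)

lift_definition act :: "U \<Rightarrow> Udot \<Rightarrow> Udot"  (infixr \<open>\<rhd>\<close> 75) is act_term
  by (simp add: fun_eq_iff act_term_cong)

lemma act_one [simp]: "1 \<rhd> x = x"
  by transfer simp

lemma act_zero_left [simp]: "0 \<rhd> x = 0"
  by transfer simp

lemma act_add_left: "(u + v) \<rhd> x = u \<rhd> x + v \<rhd> x"
  by transfer simp

lemma act_qscale_left: "(c *\<^sub>q u) \<rhd> x = c *\<^sub>q (u \<rhd> x)"
  by transfer simp

lemma act_times: "(u * v) \<rhd> x = u \<rhd> (v \<rhd> x)"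
  by transfer simp

lemma act_add_right: "u \<rhd> (x + y) = u \<rhd> x + u \<rhd> y"
  by transfer (rule act_term_add)

lemma act_qscale_right: "u \<rhd> (c *\<^sub>q x) = c *\<^sub>q (u \<rhd> x)"
  by transfer (rule act_term_qscale)

lemma act_mult_right: "u \<rhd> (x * y) = (u \<rhd> x) * y"
  by transfer (rule act_term_mult)

lemma wsum_at_idem:
  assumes "\<And>l. f l * idem l = f l"
  shows "wsum f (idem l) = f l"
  by (subst wsum_weight [where s = l]) (simp_all add: assms)

lemma act_U_E: "U_E \<rhd> x = wsum E1 x"
  and act_U_F: "U_F \<rhd> x = wsum F1 x"
  and act_U_K: "U_K \<rhd> x = wsum (\<lambda>l. q powi l *\<^sub>q idem l) x"
  and act_U_Kinv: "U_Kinv \<rhd> x = wsum (\<lambda>l. q powi (- l) *\<^sub>q idem l) x"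
  by (simp_all add: U_E_def U_F_def U_K_def U_Kinv_def act.abs_eq)

lemma act_idem:
  "U_E \<rhd> idem l = E1 l"
  "U_F \<rhd> idem l = F1 l"
  "U_K \<rhd> idem l = q powi l *\<^sub>q idem l"
  "U_Kinv \<rhd> idem l = q powi (- l) *\<^sub>q idem l"
  unfolding act_U_E act_U_F act_U_K act_U_Kinv
  by (rule wsum_at_idem, simp add: mult_qscale_left)+

section \<open>Integral forms\<close>

inductive_set Udot_A :: "Udot set" where
  idem: "idem l \<in> Udot_A"
| divE: "divE n \<rhd> idem l \<in> Udot_A"
| divF: "divF n \<rhd> idem l \<in> Udot_A"
| add: "x \<in> Udot_A \<Longrightarrow> y \<in> Udot_A \<Longrightarrow> x + y \<in> Udot_A"
| qscale: "c \<in> Laurent \<Longrightarrow> x \<in> Udot_A \<Longrightarrow> c *\<^sub>q x \<in> Udot_A"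
| mult: "x \<in> Udot_A \<Longrightarrow> y \<in> Udot_A \<Longrightarrow> x * y \<in> Udot_A"

text \<open>The sum over \<open>l\<close> is direct because the idempotents are orthogonal.\<close>
definition Udot_A_odd :: "Udot set" where
  "Udot_A_odd =
     {(\<Sum>l\<in>S. x l * idem (2 * l - 1)) | S x. finite S \<and> (\<forall>l\<in>S. x l \<in> Udot_A)}"

end

theory Submission
  imports Defs
begin

text \<open>
  Fix an odd weight \<open>w\<close>. Multiplying \<open>E\<^sup>(\<^sup>a\<^sup>) F\<^sup>(\<^sup>b\<^sup>) 1\<^sub>w\<close> by \<open>t\<close> from the left
  gives a combination of the elements of the same form with exponents
  \<open>(a + 1, b)\<close>, \<open>(a, b + 1)\<close>, \<open>(a - 1, b)\<close> and \<open>(a, b)\<close> (\<open>t_pbw\<close>). So \<open>t\<close> acts on families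
  of coefficients by a four-term operator \<open>t_step w\<close> (\<open>act_t_expansion\<close>), and the recursion of the
  \<open>\<iota>\<close>-divided powers becomes a recursion for the coefficients of \<open>E\<^sup>(\<^sup>a\<^sup>) F\<^sup>(\<^sup>b\<^sup>) 1\<^sub>w\<close>. It determines them,
  hence it suffices that the claimed coefficients satisfy it.

  The claimed coefficients look simpler in the variables \<open>s = b - a - w\<close> and \<open>c\<close>, half of the degree
  defect \<open>n - a - b\<close> rounded down. Each of them is a power of \<open>q\<close> times a binomial coefficient, as
  follows.

    \<^item> \<open>n\<close> even, \<open>n - a - b\<close> even: exponent \<open>s (a + c)\<close>, upper entry \<open>(s + 1) / 2\<close>;
    \<^item> \<open>n\<close> even, \<open>n - a - b\<close> odd: exponent \<open>s (a + c + 1) - c\<close>, upper entry \<open>s / 2\<close>;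
    \<^item> \<open>n\<close> odd, \<open>n - a - b\<close> even: exponent \<open>s (a + c) + c\<close>, upper entry \<open>s / 2\<close>;
    \<^item> \<open>n\<close> odd, \<open>n - a - b\<close> odd: exponent \<open>s (a + c + 1)\<close>, upper entry \<open>(s - 1) / 2\<close>.

  The lower entry is always \<open>c\<close>; the upper entries are integers because \<open>w\<close> is odd. In each
  of the four cases, all exponents in the recursion differ from a common one by a
  linear expression. After dividing by this common power of \<open>q\<close> and collecting quantum integers,
  what remains is one and the same identity for the \<open>q\<^sup>2\<close>-binomial coefficients \<open>B k c\<close>,
  \<open>[x + 2 c] B (k + 1) c = [x] B k c + [x + 2 k + 2] B k (c - 1)\<close>,
  with \<open>x\<close> specialised to \<open>b\<close>, \<open>b\<close>, \<open>- a - 2 c\<close> and \<open>- a - 1 - 2 c\<close> (\<open>qbinom2_int_three_term\<close>).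
  Here \<open>x\<close> may be any integer; cancelling a common factor turns the identity into a quadratic
  relation between quantum integers (\<open>qint_pluecker\<close>).

  Two special values of \<open>x\<close> combine to the Pascal rule, so the binomial coefficients, and with them
  all coefficients of the expansion, are integral Laurent polynomials. This gives the integrality.
\<close>

section \<open>Quantum integers and binomial coefficients\<close>

lemma q_diff_nonzero: "q - inverse q \<noteq> 0"
  using q_powi_diff_nonzero [of 1] by (simp add: power_int_minus)

lemma qint_times_diff: "qint n * (q - inverse q) = q powi n - q powi (- n)"
  using q_diff_nonzero by (simp add: qint_def)

lemma qint_uminus: "qint (- n) = - qint n"
  by (simp add: qint_def diff_divide_distrib)

lemma qint_1 [simp]: "qint 1 = 1"
  using q_diff_nonzero by (simp add: qint_def power_int_minus)

text \<open>
  Up to the factor \<open>q - q\<^sup>-\<^sup>1\<close>, \<open>[i - j]\<close> is the determinant with columns \<open>(q\<^sup>i, q\<^sup>-\<^sup>i)\<close> and \<open>(q\<^sup>j, q\<^sup>-\<^sup>j)\<close>.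
  The equation is the Pluecker relation for four such columns.
\<close>
lemma qint_pluecker:
  "qint (x + y) * qint z = qint x * qint (z - y) + qint (x + z) * qint y"
proof -
  let ?D = "q - inverse q"
  have "(qint (x + y) * ?D) * (qint z * ?D) =
      (qint x * ?D) * (qint (z - y) * ?D) + (qint (x + z) * ?D) * (qint y * ?D)"
    unfolding qint_times_diff
    by (simp add: power_int_add power_int_diff power_int_minus field_simps)
  then have "(qint (x + y) * qint z) * (?D * ?D) =
      (qint x * qint (z - y) + qint (x + z) * qint y) * (?D * ?D)"
    by algebra
  then show ?thesis using q_diff_nonzero by simp
qed

lemma q_powi_add_diff:
  "q powi (i + j) = q powi i * q powi j" "q powi (i - j) = q powi i * q powi (- j)"
  using power_int_add [of q i j] power_int_add [of q i "- j"] by simp_all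

text \<open>
  Up to the factor \<open>q - q\<^sup>-\<^sup>1\<close>, the product \<open>q\<^sup>x [y]\<close> is the difference of the powers of \<open>q\<close> at the end
  points of the interval from \<open>x - y\<close> to \<open>x + y\<close>. Adjacent intervals therefore add up to their union;
  the sums in the recursion for the coefficients are evaluated in this way.
\<close>
lemma qint_concat:
  assumes "x + y = z - w" "u + v = z + w" "u - v = x - y"
  shows "q powi x * qint y + q powi z * qint w = q powi u * qint v"
proof -
  have powi_qint: "q powi i * qint j = (q powi (i + j) - q powi (i - j)) / (q - inverse q)" for i j
    unfolding qint_def q_powi_add_diff by (simp add: right_diff_distrib)
  have "q powi x * qint y + q powi z * qint w =
      (q powi (x + y) - q powi (x - y) + (q powi (z + w) - q powi (z - w))) / (q - inverse q)"
    by (simp only: powi_qint add_divide_distrib)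
  also have "\<dots> = (q powi (u + v) - q powi (u - v)) / (q - inverse q)"
    unfolding assms by simp
  finally show ?thesis by (simp only: powi_qint)
qed

lemma qint_add: "qint (x + y) = q powi y * qint x + q powi (- x) * qint y"
  using qint_concat [of "- x" y y x 0 "x + y"] by (simp add: add.commute)

lemma qint_Suc: "q powi (- 1) * qint x + q powi x = qint (x + 1)"
  using qint_concat [of "- 1" x x 1 0 "x + 1"] by simp

lemma qbinom2_0 [simp]: "qbinom2 k 0 = 1"
  by (simp add: qbinom2_def)

lemma qbinom2_Suc:
  "qint (2 * (int c + 1)) * qbinom2 k (Suc c) = qint (2 * (k - int c)) * qbinom2 k c"
proof -
  have "qbinom2 k (Suc c) = qbinom2 k c * (qint (2 * (k - int c)) / qint (2 * (int c + 1)))"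
    using q_diff_nonzero unfolding qbinom2_def qint_def by (simp add: add.commute)
  then show ?thesis by (simp add: qint_nonzero)
qed

lemma qbinom2_Suc_Suc:
  "qint (2 * (int c + 1)) * qbinom2 (k + 1) (Suc c) = qint (2 * (k + 1)) * qbinom2 k c"
proof (induction c)
  case 0
  show ?case using qbinom2_Suc [of 0 "k + 1"] by simp
next
  case (Suc c)
  have "qint (2 * (int (Suc c) + 1)) * qbinom2 (k + 1) (Suc (Suc c)) =
      qint (2 * (k - int c)) * qbinom2 (k + 1) (Suc c)"
    using qbinom2_Suc [of "Suc c" "k + 1"] by simp
  then have "qint (2 * (int c + 1)) * (qint (2 * (int (Suc c) + 1)) * qbinom2 (k + 1) (Suc (Suc c)))
     = qint (2 * (int c + 1)) * (qint (2 * (k + 1)) * qbinom2 k (Suc c))"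
    using Suc.IH qbinom2_Suc [of c k] by algebra
  then show ?case by (simp add: qint_nonzero)
qed

text \<open>
  Negative lower entries occur at the boundary of the range of summation; with the value \<open>0\<close> there,
  the identities below hold for all integers, so that the recursion has no boundary cases.
\<close>
definition qbinom2_int :: "int \<Rightarrow> int \<Rightarrow> Qq" where
  "qbinom2_int k c = (if c < 0 then 0 else qbinom2 k (nat c))"

lemma qbinom2_int_of_nat [simp]: "qbinom2_int k (int c) = qbinom2 k c"
  by (simp add: qbinom2_int_def)

lemma qbinom2_int_neg [simp]: "c < 0 \<Longrightarrow> qbinom2_int k c = 0"
  by (simp add: qbinom2_int_def)

text \<open>
  For \<open>c > 0\<close>, all three binomial coefficients are multiples of \<open>qbinom2 k (c - 1)\<close>, up to the common
  denominator \<open>[2 c]\<close>. The multipliers satisfy the relation \<open>qint_pluecker\<close>.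
\<close>
lemma qbinom2_int_three_term:
  "qint (b + 2 * c) * qbinom2_int (k + 1) c =
   qint b * qbinom2_int k c + qint (b + 2 * (k + 1)) * qbinom2_int k (c - 1)"
proof -
  consider "c < 0" | "c = 0" | j where "c = int (Suc j)"
  proof (cases c)
    case (nonneg n)
    then show ?thesis using that by (cases n) auto
  qed (use that in auto)
  then show ?thesis
  proof cases
    case 3
    let ?B = "qbinom2 k j"
    have c: "c = int j + 1" using 3 by simp
    have Suc: "qbinom2_int x c = qbinom2 x (Suc j)" for x
      unfolding 3 by (rule qbinom2_int_of_nat)
    have B: "qbinom2_int k (c - 1) = ?B" using 3 by simp
    have 1: "qint (2 * c) * qbinom2_int (k + 1) c = qint (2 * (k + 1)) * ?B"
      unfolding Suc unfolding c by (rule qbinom2_Suc_Suc)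
    have 2: "qint (2 * c) * qbinom2_int k c = qint (2 * (k + 1) - 2 * c) * ?B"
    proof -
      have "2 * (k + 1) - 2 * (int j + 1) = 2 * (k - int j)" by simp
      then show ?thesis unfolding Suc unfolding c by (simp only: qbinom2_Suc)
    qed
    have "qint (2 * c) * (qint (b + 2 * c) * qbinom2_int (k + 1) c) =
        qint (b + 2 * c) * (qint (2 * (k + 1)) * ?B)"
      by (simp only: 1 mult.left_commute [of "qint (2 * c)"])
    also have "\<dots> = qint b * (qint (2 * (k + 1) - 2 * c) * ?B)
        + qint (b + 2 * (k + 1)) * (qint (2 * c) * ?B)"
      by (simp only: mult.assoc [symmetric] distrib_right [symmetric]
          qint_pluecker [of b "2 * c" "2 * (k + 1)"])
    also have "\<dots> = qint (2 * c) *
        (qint b * qbinom2_int k c + qint (b + 2 * (k + 1)) * qbinom2_int k (c - 1))"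
      by (simp only: 2 B distrib_left [of "qint (2 * c)"] mult.left_commute [of "qint (2 * c)"])
    finally show ?thesis using 3 by (simp add: qint_nonzero)
  qed (simp_all add: qbinom2_int_def)
qed

text \<open>
  The instance \<open>b = - (x + 2 c)\<close>, with all signs removed by \<open>[- n] = - [n]\<close>.
\<close>
lemma qbinom2_int_three_term_reflected:
  "qint x * qbinom2_int (k + 1) c =
   qint (x + 2 * c) * qbinom2_int k c + qint (x + 2 * c - 2 * (k + 1)) * qbinom2_int k (c - 1)"
proof -
  have "- (x + 2 * c) + 2 * c = - x"
    "- (x + 2 * c) + 2 * (k + 1) = - (x + 2 * c - 2 * (k + 1))" by simp_all
  with qbinom2_int_three_term [of "- (x + 2 * c)" c k]
  have "- (qint x * qbinom2_int (k + 1) c) = - (qint (x + 2 * c) * qbinom2_int k c)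
      + - (qint (x + 2 * c - 2 * (k + 1)) * qbinom2_int k (c - 1))"
    by (simp only: qint_uminus mult_minus_left)
  then show ?thesis
    by (simp only: minus_add_distrib [symmetric] neg_equal_iff_equal)
qed

text \<open>
  The three-term identity for \<open>b = - 2 c\<close> has a vanishing left-hand side, and for \<open>b = 1 - 2 c\<close> its
  left-hand side has coefficient \<open>1\<close>. Subtracting \<open>q\<^sup>-\<^sup>1\<close> times the former from the latter turns the
  quantum integers into powers of \<open>q\<close>.
\<close>
lemma qbinom2_int_pascal:
  "qbinom2_int (k + 1) c = q powi (- 2 * c) * qbinom2_int k c
     + q powi (2 * (k + 1) - 2 * c) * qbinom2_int k (c - 1)"
proof -
  let ?Y = "qbinom2_int k c" and ?Z = "qbinom2_int k (c - 1)" and ?d = "2 * (k + 1) - 2 * c"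
  have 0: "qint (- 2 * c) * ?Y + qint ?d * ?Z = 0"
    using qbinom2_int_three_term [of "- 2 * c" c k] by (simp add: add.commute)
  have "qbinom2_int (k + 1) c = qint (- 2 * c + 1) * ?Y + qint (?d + 1) * ?Z"
    using qbinom2_int_three_term [of "1 - 2 * c" c k] by (simp add: algebra_simps)
  also have "\<dots> = q powi (- 1) * (qint (- 2 * c) * ?Y + qint ?d * ?Z)
      + q powi (- 2 * c) * ?Y + q powi ?d * ?Z"
    by (simp only: qint_Suc [symmetric] distrib_right distrib_left add.assoc mult.assoc add.left_commute)
  finally show ?thesis unfolding 0 by simp
qed

section \<open>The action of the generators on weight vectors\<close>

text \<open>
  On such elements the infinite sums defining the action of the generators have at most one nonzero term.
\<close>
definition has_weight :: "int \<Rightarrow> Udot \<Rightarrow> bool" where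
  "has_weight n x \<longleftrightarrow> idem n * x = x"

lemma act_zero_right [simp]: "u \<rhd> 0 = 0"
  using act_qscale_right [of u 0 0] by simp

lemma act_diff_left: "(u - v) \<rhd> x = u \<rhd> x - v \<rhd> x"
  using act_add_left [of "u - v" v x] by simp

lemma act_sum_right: "u \<rhd> (\<Sum>i\<in>S. f i) = (\<Sum>i\<in>S. u \<rhd> f i)"
  by (induction S rule: infinite_finite_induct) (simp_all add: act_add_right)

lemma qscale_diff_right: "c *\<^sub>q (x - y) = c *\<^sub>q x - c *\<^sub>q (y::'a::Qq_algebra)"
  using qscale_add_right [of c "x - y" y] by simp

lemma qscale_sum_right: "c *\<^sub>q (\<Sum>i\<in>S. f i) = (\<Sum>i\<in>S. c *\<^sub>q (f i :: 'a :: Qq_algebra))"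
  by (induction S rule: infinite_finite_induct) (simp_all add: qscale_add_right)

lemma qscale_minus_left: "(- c) *\<^sub>q (x::'a::Qq_algebra) = - (c *\<^sub>q x)"
  using qscale_add_left [of "- c" c x] by (simp add: eq_neg_iff_add_eq_0)

lemma has_weight_idem: "has_weight n (idem n)"
  by (simp add: has_weight_def)

lemma has_weight_qscale: "has_weight n x \<Longrightarrow> has_weight n (c *\<^sub>q x)"
  by (simp add: has_weight_def mult_qscale_right)

lemma U_E_weight: "has_weight n x \<Longrightarrow> U_E \<rhd> x = E1 n * x"
  and U_F_weight: "has_weight n x \<Longrightarrow> U_F \<rhd> x = F1 n * x"
  and U_K_weight: "has_weight n x \<Longrightarrow> U_K \<rhd> x = q powi n *\<^sub>q x"
  and U_Kinv_weight: "has_weight n x \<Longrightarrow> U_Kinv \<rhd> x = q powi (- n) *\<^sub>q x"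
  unfolding act_U_E act_U_F act_U_K act_U_Kinv has_weight_def
  by (subst wsum_weight [where s = n]; simp add: mult_qscale_left)+

lemma has_weight_U_E: "has_weight n x \<Longrightarrow> has_weight (n + 2) (U_E \<rhd> x)"
  by (simp add: U_E_weight) (simp add: has_weight_def flip: mult.assoc)

lemma has_weight_U_F: "has_weight n x \<Longrightarrow> has_weight (n - 2) (U_F \<rhd> x)"
  by (simp add: U_F_weight) (simp add: has_weight_def flip: mult.assoc)

lemma has_weight_U_E_power: "has_weight n x \<Longrightarrow> has_weight (n + 2 * int a) (U_E ^ a \<rhd> x)"
proof (induction a)
  case (Suc a)
  then show ?case using has_weight_U_E [of "n + 2 * int a" "U_E ^ a \<rhd> x"]
    by (simp add: act_times algebra_simps)
qed simp

lemma has_weight_U_F_power: "has_weight n x \<Longrightarrow> has_weight (n - 2 * int b) (U_F ^ b \<rhd> x)"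
proof (induction b)
  case (Suc b)
  then show ?case using has_weight_U_F [of "n - 2 * int b" "U_F ^ b \<rhd> x"]
    by (simp add: act_times algebra_simps)
qed simp

lemma F_E_weight:
  assumes "has_weight n x"
  shows "U_F \<rhd> (U_E \<rhd> x) = U_E \<rhd> (U_F \<rhd> x) - qint n *\<^sub>q x"
proof -
  have "(U_E * U_F - U_F * U_E) \<rhd> x = inverse (q - inverse q) *\<^sub>q ((U_K - U_Kinv) \<rhd> x)"
    by (simp only: U_relations act_qscale_left)
  also have "\<dots> = qint n *\<^sub>q x"
  proof -
    have "(c - d) *\<^sub>q x = c *\<^sub>q x - d *\<^sub>q x" for c d
      using qscale_add_left [of c "- d" x] by (simp add: qscale_minus_left)
    then have "(U_K - U_Kinv) \<rhd> x = (q powi n - q powi (- n)) *\<^sub>q x"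
      by (simp only: act_diff_left U_K_weight [OF assms] U_Kinv_weight [OF assms])
    then show ?thesis
      by (simp add: qscale_qscale qint_def divide_inverse mult.commute)
  qed
  finally show ?thesis by (simp add: act_diff_left act_times algebra_simps)
qed

text \<open>
  Moving \<open>F\<close> past one more \<open>E\<close> costs a term \<open>[n + 2 a] E\<^sup>a x\<close>, since \<open>E\<^sup>a x\<close> has weight \<open>n + 2 a\<close>. These
  costs add up to \<open>[a] [n + a - 1]\<close>, again by \<open>qint_pluecker\<close>.
\<close>
lemma F_E_power_weight:
  assumes x: "has_weight n x"
  shows "U_F \<rhd> (U_E ^ a \<rhd> x) =
    U_E ^ a \<rhd> (U_F \<rhd> x) - (qint (int a) * qint (n + int a - 1)) *\<^sub>q (U_E ^ (a - 1) \<rhd> x)"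
proof (induction a)
  case (Suc a)
  have "U_F \<rhd> (U_E ^ Suc a \<rhd> x) =
      U_E \<rhd> (U_F \<rhd> (U_E ^ a \<rhd> x)) - qint (n + 2 * int a) *\<^sub>q (U_E ^ a \<rhd> x)"
    using F_E_weight [OF has_weight_U_E_power [OF x]] by (simp add: act_times)
  also have "U_E \<rhd> (U_F \<rhd> (U_E ^ a \<rhd> x)) = U_E ^ Suc a \<rhd> (U_F \<rhd> x)
      - (qint (int a) * qint (n + int a - 1)) *\<^sub>q (U_E ^ a \<rhd> x)"
  proof -
    have "U_E \<rhd> (y - c *\<^sub>q z) = U_E \<rhd> y - c *\<^sub>q (U_E \<rhd> z)" for y c z
      using act_add_right [of U_E "y - c *\<^sub>q z" "c *\<^sub>q z"] by (simp add: act_qscale_right)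
    then show ?thesis unfolding Suc.IH by (cases a) (simp_all add: act_times)
  qed
  also have "\<dots> - qint (n + 2 * int a) *\<^sub>q (U_E ^ a \<rhd> x) = U_E ^ Suc a \<rhd> (U_F \<rhd> x) -
      (qint (int a) * qint (n + int a - 1) + qint (n + 2 * int a)) *\<^sub>q (U_E ^ a \<rhd> x)"
    by (simp add: qscale_add_left)
  also have "qint (int a) * qint (n + int a - 1) + qint (n + 2 * int a)
      = qint (int (Suc a)) * qint (n + int (Suc a) - 1)"
    using qint_pluecker [of "int a" 1 "n + int a"] by (simp add: algebra_simps)
  finally show ?case by simp
qed simp

definition pbw :: "int \<Rightarrow> nat \<Rightarrow> nat \<Rightarrow> Udot" where
  "pbw l a b = (divE a * divF b) \<rhd> idem l"

lemma qfact_Suc: "qfact (Suc n) = qint (int (Suc n)) * qfact n"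
  by (simp add: qfact_def)

lemma qint_inverse_qfact: "qint (int (Suc n)) * inverse (qfact (Suc n)) = inverse (qfact n)"
  using qint_nonzero [of "int (Suc n)"] by (simp add: qfact_Suc)

lemma E_divE: "U_E * divE a = qint (int (Suc a)) *\<^sub>q divE (Suc a)"
  unfolding divE_def mult_qscale_right qscale_qscale qint_inverse_qfact by simp

lemma F_divF: "U_F * divF b = qint (int (Suc b)) *\<^sub>q divF (Suc b)"
  unfolding divF_def mult_qscale_right qscale_qscale qint_inverse_qfact by simp

lemma has_weight_divF: "has_weight (l - 2 * int b) (divF b \<rhd> idem l)"
  by (simp add: divF_def act_qscale_left has_weight_qscale has_weight_U_F_power has_weight_idem)

lemma has_weight_pbw: "has_weight (l - 2 * int b + 2 * int a) (pbw l a b)"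
  unfolding pbw_def divE_def act_times act_qscale_left
  by (intro has_weight_qscale has_weight_U_E_power has_weight_divF)

lemma E_pbw: "U_E \<rhd> pbw l a b = qint (int (Suc a)) *\<^sub>q pbw l (Suc a) b"
  unfolding pbw_def
  by (simp add: E_divE mult_qscale_left act_qscale_left flip: act_times mult.assoc)

lemma F_pbw:
  "U_F \<rhd> pbw l a b = qint (int (Suc b)) *\<^sub>q pbw l a (Suc b) -
     (if a = 0 then 0 else qint (l - 2 * int b + int a - 1) *\<^sub>q pbw l (a - 1) b)"
proof -
  let ?y = "divF b \<rhd> idem l"
  have "U_F \<rhd> pbw l a b = inverse (qfact a) *\<^sub>q (U_F \<rhd> (U_E ^ a \<rhd> ?y))"
    by (simp add: pbw_def divE_def act_times act_qscale_left act_qscale_right)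
  also have "\<dots> = divE a \<rhd> (U_F \<rhd> ?y) -
      (inverse (qfact a) * qint (int a) * qint (l - 2 * int b + int a - 1)) *\<^sub>q
        (U_E ^ (a - 1) \<rhd> ?y)"
    unfolding F_E_power_weight [OF has_weight_divF]
    by (simp add: divE_def act_qscale_left qscale_diff_right qscale_qscale mult.assoc)
  also have "divE a \<rhd> (U_F \<rhd> ?y) = qint (int (Suc b)) *\<^sub>q pbw l a (Suc b)"
    by (simp only: pbw_def act_times [of U_F, symmetric] F_divF act_qscale_left act_qscale_right
        act_times [of "divE a"])
  also have "(inverse (qfact a) * qint (int a) * qint (l - 2 * int b + int a - 1)) *\<^sub>q
        (U_E ^ (a - 1) \<rhd> ?y) =
     (if a = 0 then 0 else qint (l - 2 * int b + int a - 1) *\<^sub>q pbw l (a - 1) b)"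
  proof (cases a)
    case (Suc k)
    have "inverse (qfact a) * qint (int a) * z = z * inverse (qfact k)" for z
      unfolding Suc qint_inverse_qfact [of k, symmetric] by (simp only: ac_simps)
    then show ?thesis
      by (simp only:) (simp add: Suc pbw_def divE_def act_times act_qscale_left qscale_qscale)
  qed simp
  finally show ?thesis .
qed

lemma Kinv_pbw: "U_Kinv \<rhd> pbw l a b = q powi (- (l - 2 * int b + 2 * int a)) *\<^sub>q pbw l a b"
  by (rule U_Kinv_weight [OF has_weight_pbw])

lemma t_pbw:
  "t \<rhd> pbw l a b =
     (q powi (- (l - 2 * int b + 2 * int a) - 1) * qint (int (Suc a))) *\<^sub>q pbw l (Suc a) b
   + qint (int (Suc b)) *\<^sub>q pbw l a (Suc b)
   - (if a = 0 then 0 else qint (l - 2 * int b + int a - 1) *\<^sub>q pbw l (a - 1) b)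
   + q powi (- (l - 2 * int b + 2 * int a)) *\<^sub>q pbw l a b"
  unfolding t_def Echeck_def
  using power_int_add [of q "- (l - 2 * int b + 2 * int a)" "- 1"]
  by (simp add: act_add_left act_qscale_left act_qscale_right act_times Kinv_pbw E_pbw F_pbw
      qscale_qscale power_int_minus mult.commute mult.left_commute)

section \<open>The action of \<open>t\<close> on expansions\<close>

text \<open>
  The matrix of \<open>t\<close> in the elements \<open>pbw w a b\<close>, read as an operator on coefficient functions. The
  coefficient functions have integral arguments; the factors \<open>[a]\<close> and \<open>[b]\<close> remove the values at
  negative arguments when \<open>a = 0\<close> or \<open>b = 0\<close>.
\<close>
definition t_step :: "int \<Rightarrow> (int \<Rightarrow> int \<Rightarrow> Qq) \<Rightarrow> int \<Rightarrow> int \<Rightarrow> Qq" where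
  "t_step w f a b =
     q powi (1 - w - 2 * a + 2 * b) * qint a * f (a - 1) b
   + qint b * f a (b - 1)
   - qint (w - 2 * b + a) * f (a + 1) b
   + q powi (- (w - 2 * b + 2 * a)) * f a b"

definition expansion :: "int \<Rightarrow> nat \<Rightarrow> (int \<Rightarrow> int \<Rightarrow> Qq) \<Rightarrow> Udot" where
  "expansion w N f = (\<Sum>a\<le>N. \<Sum>b\<le>N. f (int a) (int b) *\<^sub>q pbw w a b)"

lemma expansion_add:
  "expansion w N (\<lambda>a b. f a b + g a b) = expansion w N f + expansion w N g"
  by (simp add: expansion_def qscale_add_left sum.distrib)

lemma expansion_qscale: "expansion w N (\<lambda>a b. c * f a b) = c *\<^sub>q expansion w N f"
  by (simp add: expansion_def qscale_sum_right qscale_qscale)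

lemma sum_Suc_eq_sum:
  fixes h :: "nat \<Rightarrow> 'a::comm_monoid_add"
  assumes "h 0 = 0" "h (Suc N) = 0"
  shows "(\<Sum>i\<le>N. h (Suc i)) = (\<Sum>i\<le>N. h i)"
  using sum.atMost_Suc_shift [of h N] sum.atMost_Suc [of h N] assms by simp

text \<open>
  Because \<open>f\<close> vanishes on the upper edges of the square of summation, raising an index does not lead out
  of it. Lowering \<open>a\<close> does so only at \<open>a = 0\<close>, where \<open>t_pbw\<close> has no such term.
\<close>
lemma act_t_expansion:
  assumes f: "\<And>a b. N \<le> a \<or> N \<le> b \<Longrightarrow> f (int a) (int b) = 0"
  shows "t \<rhd> expansion w N f = expansion w N (t_step w f)"
proof -
  let ?e = "\<lambda>a b. q powi (1 - w - 2 * int a + 2 * int b) * qint (int a) * f (int a - 1) (int b)"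
  let ?f = "\<lambda>a b. qint (int b) * f (int a) (int b - 1)"
  let ?g = "\<lambda>a b. qint (w - 2 * int b + int a) * f (int a + 1) (int b)"
  let ?k = "\<lambda>a b. q powi (- (w - 2 * int b + 2 * int a)) * f (int a) (int b)"
  let ?h = "\<lambda>a. \<Sum>b\<le>N. (if a = 0 then 0 else ?g (a - 1) b) *\<^sub>q pbw w (a - 1) b"
  have "f (int a) (int b) *\<^sub>q (t \<rhd> pbw w a b) =
      ?e (Suc a) b *\<^sub>q pbw w (Suc a) b + ?f a (Suc b) *\<^sub>q pbw w a (Suc b)
      - (if a = 0 then 0 else ?g (a - 1) b) *\<^sub>q pbw w (a - 1) b + ?k a b *\<^sub>q pbw w a b" for a b
    unfolding t_pbw
    by (cases a) (simp_all add: qscale_add_right qscale_diff_right qscale_qscale ac_simps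
        power_int_minus algebra_simps)
  then have "t \<rhd> expansion w N f =
      (\<Sum>a\<le>N. \<Sum>b\<le>N. ?e (Suc a) b *\<^sub>q pbw w (Suc a) b)
    + (\<Sum>a\<le>N. \<Sum>b\<le>N. ?f a (Suc b) *\<^sub>q pbw w a (Suc b))
    - (\<Sum>a\<le>N. ?h a)
    + (\<Sum>a\<le>N. \<Sum>b\<le>N. ?k a b *\<^sub>q pbw w a b)"
    by (simp add: expansion_def act_sum_right act_qscale_right sum.distrib sum_subtractf)
  also have "(\<Sum>a\<le>N. \<Sum>b\<le>N. ?e (Suc a) b *\<^sub>q pbw w (Suc a) b) =
      (\<Sum>a\<le>N. \<Sum>b\<le>N. ?e a b *\<^sub>q pbw w a b)"
    by (rule sum_Suc_eq_sum [of "\<lambda>a. \<Sum>b\<le>N. ?e a b *\<^sub>q pbw w a b"]) (simp_all add: f)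
  also have "(\<Sum>a\<le>N. \<Sum>b\<le>N. ?f a (Suc b) *\<^sub>q pbw w a (Suc b)) =
      (\<Sum>a\<le>N. \<Sum>b\<le>N. ?f a b *\<^sub>q pbw w a b)"
    by (intro sum.cong refl sum_Suc_eq_sum [of "\<lambda>b. ?f _ b *\<^sub>q pbw w _ b"]) (simp_all add: f)
  also have "(\<Sum>a\<le>N. ?h a) = (\<Sum>a\<le>N. ?h (Suc a))"
    using f [of "Suc N"] by (intro sum_Suc_eq_sum [symmetric]) (simp_all add: add.commute)
  also have "\<dots> = (\<Sum>a\<le>N. \<Sum>b\<le>N. ?g a b *\<^sub>q pbw w a b)"
    by simp
  finally show ?thesis
  proof -
    have sub: "(c - d) *\<^sub>q x = c *\<^sub>q x - d *\<^sub>q x" for c d and x :: Udot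
      using qscale_add_left [of c "- d" x] by (simp add: qscale_minus_left)
    assume "t \<rhd> expansion w N f = (\<Sum>a\<le>N. \<Sum>b\<le>N. ?e a b *\<^sub>q pbw w a b)
      + (\<Sum>a\<le>N. \<Sum>b\<le>N. ?f a b *\<^sub>q pbw w a b) - (\<Sum>a\<le>N. \<Sum>b\<le>N. ?g a b *\<^sub>q pbw w a b)
      + (\<Sum>a\<le>N. \<Sum>b\<le>N. ?k a b *\<^sub>q pbw w a b)"
    then show ?thesis
      unfolding expansion_def t_step_def
      by (simp only: sub qscale_add_left sum.distrib sum_subtractf)
  qed
qed

section \<open>The recursion for the coefficients\<close>

text \<open>
  The next four lemmas are the coefficient recursion in the variables \<open>a\<close>, \<open>b\<close>, \<open>c\<close>, \<open>s\<close>: the names tell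
  the parity of the index \<open>n\<close> to which \<open>t\<close> is applied, and whether \<open>a + b\<close> has the parity of \<open>n + 1\<close>.
  The factors \<open>B1\<close>, \<open>B0\<close> and \<open>Bm\<close> stand for the binomial coefficients with entries \<open>(k + 1, c)\<close>, \<open>(k, c)\<close>
  and \<open>(k, c - 1)\<close>, where \<open>k\<close> depends on the case. The hypothesis is an instance of their three-term
  identity; it becomes the conclusion after multiplication by a power of \<open>q\<close> whose exponent is a
  quadratic polynomial in \<open>a\<close>, \<open>c\<close>, \<open>s\<close>, up to terms that combine by \<open>qint_concat\<close>.
\<close>
lemma recurrence_odd_step_same_parity:
  assumes "qint (b + 2 * c) * B1 = qint b * B0 + qint (b + (s + 1)) * Bm"
  shows "q powi (1 + s - a + b) * qint a * (q powi ((s + 1) * (a - 1 + c) + c) * B1)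
     + qint b * (q powi ((s - 1) * (a + c) + c) * B0)
     + qint (s + b) * (q powi ((s - 1) * (a + c) + (c - 1)) * Bm)
     + q powi (s - a + b) * (q powi (s * (a + c)) * Bm)
     = qint (a + b + 2 * c) * (q powi (s * (a + c)) * B1)" (is "?L = _")
proof -
  let ?Q = "q powi (s * (a + c))"
  have pow: "q powi (1 + s - a + b) * q powi ((s + 1) * (a - 1 + c) + c) = ?Q * q powi (b + 2 * c)"
    "q powi ((s - 1) * (a + c) + c) = ?Q * q powi (- a)"
    "q powi ((s - 1) * (a + c) + (c - 1)) = ?Q * (q powi (- a) * q powi (- 1))"
    "q powi (s - a + b) = q powi (- a) * q powi (s + b)"
    unfolding power_int_add [OF disjI1 [OF q_nonzero], symmetric]
    by (simp_all add: algebra_simps)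
  have "?L = ?Q * (q powi (b + 2 * c) * qint a * B1 + q powi (- a) * (qint b * B0)
     + q powi (- a) * (q powi (- 1) * qint (s + b) + q powi (s + b)) * Bm)"
    using pow by algebra
  also have "\<dots> = ?Q * (q powi (b + 2 * c) * qint a * B1 +
      q powi (- a) * (qint b * B0 + qint (b + (s + 1)) * Bm))"
    unfolding qint_Suc by (simp add: algebra_simps)
  also have "\<dots> = qint (a + (b + 2 * c)) * (?Q * B1)"
    unfolding assms [symmetric] qint_add [of a] by algebra
  finally show ?thesis by (simp add: add.assoc)
qed

lemma recurrence_odd_step_opposite_parity:
  assumes "qint (b + 2 * c) * B1 = qint b * B0 + qint (b + s) * Bm"
  shows "q powi (1 + s - a + b) * qint a * (q powi ((s + 1) * (a + c)) * B1)
     + qint b * (q powi ((s - 1) * (a + c + 1)) * B0)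
     + qint (s + b) * (q powi ((s - 1) * (a + c + 1)) * Bm)
     + q powi (s - a + b) * (q powi (s * (a + c) + c) * B1)
     = qint (a + b + 2 * c + 1) * (q powi (s * (a + c + 1) - c) * B1)" (is "?L = _")
proof -
  let ?Q = "q powi (s * (a + c + 1) - c)"
  have pow: "q powi (1 + s - a + b) * q powi ((s + 1) * (a + c)) = ?Q * q powi (b + 2 * c + 1)"
    "q powi ((s - 1) * (a + c + 1)) = ?Q * (q powi (- a) * q powi (- 1))"
    "q powi (s - a + b) * q powi (s * (a + c) + c) = ?Q * (q powi (- a) * q powi (b + 2 * c))"
    unfolding power_int_add [OF disjI1 [OF q_nonzero], symmetric]
    by (simp_all add: algebra_simps)
  have "?L = ?Q * (q powi (b + 2 * c + 1) * qint a * B1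
     + q powi (- a) * (q powi (- 1) * (qint b * B0 + qint (b + s) * Bm) + q powi (b + 2 * c) * B1))"
    using pow by (simp add: add.commute [of s b], algebra)
  also have "\<dots> = ?Q * (q powi (b + 2 * c + 1) * qint a
     + q powi (- a) * (q powi (- 1) * qint (b + 2 * c) + q powi (b + 2 * c))) * B1"
    unfolding assms [symmetric] by algebra
  also have "\<dots> = qint (a + (b + 2 * c + 1)) * (?Q * B1)"
    unfolding qint_Suc unfolding qint_add [of a] by algebra
  finally show ?thesis by (simp add: add.assoc)
qed

lemma recurrence_even_step_same_parity:
  assumes "qint a * B1 = qint (a + 2 * c) * B0 + qint (a + 2 * c - (s + 2)) * Bm"
  shows "q powi (1 + s - a + b) * qint a * (q powi ((s + 1) * (a - 1 + c)) * B1)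
     + qint b * (q powi ((s - 1) * (a + c)) * B0)
     + qint (s + b) * (q powi ((s - 1) * (a + c)) * Bm)
     + q powi (s - a + b) * (q powi (s * (a + c) - (c - 1)) * Bm)
     = qint (a + b + 2 * c) * (q powi (s * (a + c) + c) * B0)
     + qint (a + b + 2 * c - 1) * (q powi (s * (a + c - 1) + (c - 1)) * Bm)" (is "?L = ?R")
proof -
  let ?Q = "q powi (s * (a + c))"
  have pow: "q powi (1 + s - a + b) * q powi ((s + 1) * (a - 1 + c)) = ?Q * q powi (b + c)"
    "q powi ((s - 1) * (a + c)) = ?Q * q powi (- (a + c))"
    "q powi (s - a + b) * q powi (s * (a + c) - (c - 1)) =
      ?Q * (q powi (- (a + c)) * q powi (s + b + 1))"
    "q powi (s * (a + c) + c) = ?Q * q powi c"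
    "q powi (s * (a + c - 1) + (c - 1)) = ?Q * q powi (c - 1 - s)"
    unfolding power_int_add [OF disjI1 [OF q_nonzero], symmetric]
    by (simp_all add: algebra_simps)
  have "q powi (- (a + c)) * qint b + q powi (b + c) * qint (a + 2 * c) = q powi c * qint (a + b + 2 * c)"
    by (rule qint_concat) simp_all
  moreover have "q powi (- (a + c)) * qint (s + b) + q powi (- (a + c)) * q powi (s + b + 1)
     + q powi (b + c) * qint (a + 2 * c - (s + 2)) = q powi (c - 1 - s) * qint (a + b + 2 * c - 1)"
  proof -
    have "q powi (- (a + c)) * qint (s + b) + q powi (- (a + c) + (s + b + 1)) * qint 1
        = q powi (1 - (a + c)) * qint (s + b + 1)"
      by (rule qint_concat) simp_all
    moreover have "\<dots> + q powi (b + c) * qint (a + 2 * c - (s + 2))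
        = q powi (c - 1 - s) * qint (a + b + 2 * c - 1)"
      by (rule qint_concat) simp_all
    ultimately show ?thesis by (simp add: power_int_add)
  qed
  moreover have "?L = ?Q * ((q powi (- (a + c)) * qint b + q powi (b + c) * qint (a + 2 * c)) * B0
    + (q powi (- (a + c)) * qint (s + b) + q powi (- (a + c)) * q powi (s + b + 1)
     + q powi (b + c) * qint (a + 2 * c - (s + 2))) * Bm)"
    using pow assms by algebra
  moreover have "?R = ?Q * (q powi c * qint (a + b + 2 * c) * B0
     + q powi (c - 1 - s) * qint (a + b + 2 * c - 1) * Bm)"
    using pow by algebra
  ultimately show ?thesis by simp
qed

lemma recurrence_even_step_opposite_parity:
  assumes "qint (a + 1) * B1 = qint (a + 1 + 2 * c) * B0 + qint (a + 1 + 2 * c - (s + 1)) * Bm"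
  shows "q powi (1 + s - a + b) * qint a * (q powi ((s + 1) * (a + c) - c) * B1)
     + qint b * (q powi ((s - 1) * (a + c + 1) - c) * B0)
     + qint (s + b) * (q powi ((s - 1) * (a + c + 1) - (c - 1)) * Bm)
     + q powi (s - a + b) * (q powi (s * (a + c)) * B1)
     = qint (a + b + 2 * c + 1) * (q powi (s * (a + c + 1)) * B0)
     + qint (a + b + 2 * c) * (q powi (s * (a + c)) * Bm)" (is "?L = ?R")
proof -
  let ?Q = "q powi (s * (a + c))"
  have pow: "q powi (1 + s - a + b) * q powi ((s + 1) * (a + c) - c) = ?Q * (q powi (s + b) * q powi 1)"
    "q powi ((s - 1) * (a + c + 1) - c) = ?Q * q powi (s - a - 2 * c - 1)"
    "q powi ((s - 1) * (a + c + 1) - (c - 1)) = ?Q * q powi (s - a - 2 * c)"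
    "q powi (s - a + b) = q powi (s + b) * q powi (- a)"
    "q powi (s * (a + c + 1)) = ?Q * q powi s"
    unfolding power_int_add [OF disjI1 [OF q_nonzero], symmetric]
    by (simp_all add: algebra_simps)
  have "q powi (s - a - 2 * c - 1) * qint b + q powi (s + b) * qint (a + 1 + 2 * c)
     = q powi s * qint (a + b + 2 * c + 1)"
    by (rule qint_concat) simp_all
  moreover have "q powi (s - a - 2 * c) * qint (s + b) + q powi (s + b) * qint (a + 1 + 2 * c - (s + 1))
     = qint (a + b + 2 * c)"
    using qint_concat [of "s - a - 2 * c" "s + b" "s + b" "a + 1 + 2 * c - (s + 1)" 0 "a + b + 2 * c"]
    by simp
  moreover have "?L = ?Q * ((q powi (s - a - 2 * c - 1) * qint b + q powi (s + b) * qint (a + 1 + 2 * c)) * B0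
    + (q powi (s - a - 2 * c) * qint (s + b) + q powi (s + b) * qint (a + 1 + 2 * c - (s + 1))) * Bm)"
    using pow assms qint_add [of a 1] by (simp, algebra)
  moreover have "?R = ?Q * (q powi s * qint (a + b + 2 * c + 1) * B0
     + qint (a + b + 2 * c) * Bm)"
    using pow by algebra
  ultimately show ?thesis by simp
qed

text \<open>
  The coefficient of \<open>E\<^sup>(\<^sup>a\<^sup>) F\<^sup>(\<^sup>b\<^sup>) 1\<^sub>w\<close> in the \<open>\<iota>\<close>-divided power with index \<open>n\<close>, for odd \<open>w\<close>; the
  divisions by \<open>2\<close> in the upper entries are then exact.
\<close>
definition idp_coeff :: "int \<Rightarrow> int \<Rightarrow> int \<Rightarrow> int \<Rightarrow> Qq" where
  "idp_coeff w n a b = (let s = b - a - w; c = (n - a - b) div 2 in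
     if even n then
       if even (n - a - b) then q powi (s * (a + c)) * qbinom2_int ((s + 1) div 2) c
       else q powi (s * (a + c + 1) - c) * qbinom2_int (s div 2) c
     else
       if even (n - a - b) then q powi (s * (a + c) + c) * qbinom2_int (s div 2) c
       else q powi (s * (a + c + 1)) * qbinom2_int ((s - 1) div 2) c)"

text \<open>
  Here the lower entry of the binomial coefficient is negative.
\<close>
lemma idp_coeff_eq_0: "n < a + b \<Longrightarrow> idp_coeff w n a b = 0"
  by (simp add: idp_coeff_def Let_def)

lemma idp_coeff_even:
  assumes "even n" "b - a - w = s"
  shows "n - a - b = 2 * c \<Longrightarrow> s + 1 = 2 * k \<Longrightarrow>
      idp_coeff w n a b = q powi (s * (a + c)) * qbinom2_int k c"
    and "n - a - b = 2 * c + 1 \<Longrightarrow> s = 2 * k \<Longrightarrow>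
      idp_coeff w n a b = q powi (s * (a + c + 1) - c) * qbinom2_int k c"
  using assms by (simp_all add: idp_coeff_def Let_def)

lemma idp_coeff_odd:
  assumes "odd n" "b - a - w = s"
  shows "n - a - b = 2 * c \<Longrightarrow> s = 2 * k \<Longrightarrow>
      idp_coeff w n a b = q powi (s * (a + c) + c) * qbinom2_int k c"
    and "n - a - b = 2 * c + 1 \<Longrightarrow> s - 1 = 2 * k \<Longrightarrow>
      idp_coeff w n a b = q powi (s * (a + c + 1)) * qbinom2_int k c"
  using assms by (simp_all add: idp_coeff_def Let_def)

lemma t_step_in_terms_of_s:
  assumes "b - a - w = s"
  shows "t_step w f a b = q powi (1 + s - a + b) * qint a * f (a - 1) b + qint b * f a (b - 1)
    + qint (s + b) * f (a + 1) b + q powi (s - a + b) * f a b"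
proof -
  have "1 - w - 2 * a + 2 * b = 1 + s - a + b" "w - 2 * b + a = - (s + b)"
    "- (w - 2 * b + 2 * a) = s - a + b" using assms by auto
  then show ?thesis by (simp only: t_step_def qint_uminus diff_minus_eq_add mult_minus_left)
qed

text \<open>
  In passing from \<open>(a, b)\<close> to \<open>(a - 1, b)\<close>, \<open>(a, b - 1)\<close> and \<open>(a + 1, b)\<close>, the variable \<open>s\<close> changes by
  \<open>1\<close>, \<open>- 1\<close> and \<open>- 1\<close>. If \<open>c\<close> belongs to the index \<open>n + 1\<close> and to \<open>(a, b)\<close>, then the coefficients
  with index \<open>n\<close> at these three places have lower entries \<open>c\<close>, \<open>c\<close> and \<open>c - 1\<close>. Together with the
  coefficient at \<open>(a, b)\<close>, only the entries \<open>(k + 1, c)\<close>, \<open>(k, c)\<close> and \<open>(k, c - 1)\<close> occur, for a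
  suitable \<open>k\<close>.
\<close>
lemma t_step_idp_coeff_odd:
  assumes "odd n" "odd w"
  shows "t_step w (idp_coeff w n) a b = qint (n + 1) * idp_coeff w (n + 1) a b"
proof -
  define s where "s = b - a - w"
  then have s: "b - a - w = s" by simp
  have even: "even (n + 1)" using assms by simp
  show ?thesis
  proof (cases "even (n + 1 - a - b)")
    case True
    then obtain c where c: "n + 1 - a - b = 2 * c" by blast
    have "even (s - 1)" using assms c s by presburger
    then obtain k where k: "s - 1 = 2 * k" by blast
    note odd = idp_coeff_odd [OF assms(1)]
    have e: "idp_coeff w n (a - 1) b = q powi ((s + 1) * (a - 1 + c) + c) * qbinom2_int (k + 1) c"
      by (rule odd(1)) (use s c k in presburger)+
    have f: "idp_coeff w n a (b - 1) = q powi ((s - 1) * (a + c) + c) * qbinom2_int k c"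
      by (rule odd(1)) (use s c k in presburger)+
    have "idp_coeff w n (a + 1) b =
        q powi ((s - 1) * (a + 1 + (c - 1)) + (c - 1)) * qbinom2_int k (c - 1)"
      by (rule odd(1)) (use s c k in presburger)+
    then have g: "idp_coeff w n (a + 1) b =
        q powi ((s - 1) * (a + c) + (c - 1)) * qbinom2_int k (c - 1)" by simp
    have "idp_coeff w n a b = q powi (s * (a + (c - 1) + 1)) * qbinom2_int k (c - 1)"
      by (rule odd(2)) (use s c k in presburger)+
    then have h: "idp_coeff w n a b = q powi (s * (a + c)) * qbinom2_int k (c - 1)" by simp
    have r: "idp_coeff w (n + 1) a b = q powi (s * (a + c)) * qbinom2_int (k + 1) c"
      by (rule idp_coeff_even(1) [OF even]) (use s c k in presburger)+
    have n: "n + 1 = a + b + 2 * c" and *: "2 * (k + 1) = s + 1" using c k by auto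
    show ?thesis
      unfolding t_step_in_terms_of_s [OF s] e f g h r unfolding n
      by (rule recurrence_odd_step_same_parity) (use qbinom2_int_three_term [of b c k] in \<open>simp only: *\<close>)
  next
    case False
    then obtain c where c: "n + 1 - a - b = 2 * c + 1" by (metis oddE)
    have "even s" using assms c s by presburger
    then obtain k where k: "s = 2 * k" by blast
    note odd = idp_coeff_odd [OF assms(1)]
    have "idp_coeff w n (a - 1) b = q powi ((s + 1) * (a - 1 + c + 1)) * qbinom2_int k c"
      by (rule odd(2)) (use s c k in presburger)+
    then have e: "idp_coeff w n (a - 1) b = q powi ((s + 1) * (a + c)) * qbinom2_int k c" by simp
    have f: "idp_coeff w n a (b - 1) = q powi ((s - 1) * (a + c + 1)) * qbinom2_int (k - 1) c"
      by (rule odd(2)) (use s c k in presburger)+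
    have "idp_coeff w n (a + 1) b =
        q powi ((s - 1) * (a + 1 + (c - 1) + 1)) * qbinom2_int (k - 1) (c - 1)"
      by (rule odd(2)) (use s c k in presburger)+
    then have g: "idp_coeff w n (a + 1) b =
        q powi ((s - 1) * (a + c + 1)) * qbinom2_int (k - 1) (c - 1)" by (simp add: algebra_simps)
    have h: "idp_coeff w n a b = q powi (s * (a + c) + c) * qbinom2_int k c"
      by (rule odd(1)) (use s c k in presburger)+
    have r: "idp_coeff w (n + 1) a b = q powi (s * (a + c + 1) - c) * qbinom2_int k c"
      by (rule idp_coeff_even(2) [OF even]) (use s c k in presburger)+
    have n: "n + 1 = a + b + 2 * c + 1" and *: "k - 1 + 1 = k" "2 * k = s" using c k by auto
    show ?thesis
      unfolding t_step_in_terms_of_s [OF s] e f g h r unfolding n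
      by (rule recurrence_odd_step_opposite_parity) (use qbinom2_int_three_term [of b c "k - 1"] in \<open>simp only: *\<close>)
  qed
qed

lemma t_step_idp_coeff_even:
  assumes "even n" "odd w"
  shows "t_step w (idp_coeff w n) a b =
    qint (n + 1) * idp_coeff w (n + 1) a b + qint n * idp_coeff w (n - 1) a b"
proof -
  define s where "s = b - a - w"
  then have s: "b - a - w = s" by simp
  note even = idp_coeff_even [OF assms(1)]
  have odd: "odd (n + 1)" "odd (n - 1)" using assms by auto
  show ?thesis
  proof (cases "even (n + 1 - a - b)")
    case True
    then obtain c where c: "n + 1 - a - b = 2 * c" by blast
    have "even s" using assms c s by presburger
    then obtain k where k: "s = 2 * k" by blast
    have e: "idp_coeff w n (a - 1) b = q powi ((s + 1) * (a - 1 + c)) * qbinom2_int (k + 1) c"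
      by (rule even(1)) (use s c k in presburger)+
    have f: "idp_coeff w n a (b - 1) = q powi ((s - 1) * (a + c)) * qbinom2_int k c"
      by (rule even(1)) (use s c k in presburger)+
    have "idp_coeff w n (a + 1) b =
        q powi ((s - 1) * (a + 1 + (c - 1))) * qbinom2_int k (c - 1)"
      by (rule even(1)) (use s c k in presburger)+
    then have g: "idp_coeff w n (a + 1) b =
        q powi ((s - 1) * (a + c)) * qbinom2_int k (c - 1)" by simp
    have "idp_coeff w n a b = q powi (s * (a + (c - 1) + 1) - (c - 1)) * qbinom2_int k (c - 1)"
      by (rule even(2)) (use s c k in presburger)+
    then have h: "idp_coeff w n a b = q powi (s * (a + c) - (c - 1)) * qbinom2_int k (c - 1)"
      by simp
    have r: "idp_coeff w (n + 1) a b = q powi (s * (a + c) + c) * qbinom2_int k c"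
      by (rule idp_coeff_odd(1) [OF odd(1)]) (use s c k in presburger)+
    have "idp_coeff w (n - 1) a b = q powi (s * (a + (c - 1)) + (c - 1)) * qbinom2_int k (c - 1)"
      by (rule idp_coeff_odd(1) [OF odd(2)]) (use s c k in presburger)+
    then have r': "idp_coeff w (n - 1) a b =
        q powi (s * (a + c - 1) + (c - 1)) * qbinom2_int k (c - 1)" by (simp add: algebra_simps)
    have n: "n + 1 = a + b + 2 * c" "n = a + b + 2 * c - 1" using c by auto
    have "qint a * qbinom2_int (k + 1) c =
        qint (a + 2 * c) * qbinom2_int k c + qint (a + 2 * c - (s + 2)) * qbinom2_int k (c - 1)"
    proof -
      have "2 * (k + 1) = s + 2" using k by simp
      then show ?thesis using qbinom2_int_three_term_reflected [of "a" k c] by (simp only:)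
    qed
    note rec = recurrence_even_step_same_parity [OF this, of b]
    have "qint n = qint (a + b + 2 * c - 1)" "qint (n + 1) = qint (a + b + 2 * c)" using n by simp_all
    then show ?thesis
      unfolding t_step_in_terms_of_s [OF s] e f g h r r' using rec by (simp only:)
  next
    case False
    then obtain c where c: "n + 1 - a - b = 2 * c + 1" by (metis oddE)
    have "even (s - 1)" using assms c s by presburger
    then obtain k where k: "s - 1 = 2 * k" by blast
    have "idp_coeff w n (a - 1) b = q powi ((s + 1) * (a - 1 + c + 1) - c) * qbinom2_int (k + 1) c"
      by (rule even(2)) (use s c k in presburger)+
    then have e: "idp_coeff w n (a - 1) b = q powi ((s + 1) * (a + c) - c) * qbinom2_int (k + 1) c"
      by simp
    have f: "idp_coeff w n a (b - 1) = q powi ((s - 1) * (a + c + 1) - c) * qbinom2_int k c"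
      by (rule even(2)) (use s c k in presburger)+
    have "idp_coeff w n (a + 1) b =
        q powi ((s - 1) * (a + 1 + (c - 1) + 1) - (c - 1)) * qbinom2_int k (c - 1)"
      by (rule even(2)) (use s c k in presburger)+
    then have g: "idp_coeff w n (a + 1) b =
        q powi ((s - 1) * (a + c + 1) - (c - 1)) * qbinom2_int k (c - 1)"
      by (simp add: algebra_simps)
    have h: "idp_coeff w n a b = q powi (s * (a + c)) * qbinom2_int (k + 1) c"
      by (rule even(1)) (use s c k in presburger)+
    have r: "idp_coeff w (n + 1) a b = q powi (s * (a + c + 1)) * qbinom2_int k c"
      by (rule idp_coeff_odd(2) [OF odd(1)]) (use s c k in presburger)+
    have "idp_coeff w (n - 1) a b = q powi (s * (a + (c - 1) + 1)) * qbinom2_int k (c - 1)"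
      by (rule idp_coeff_odd(2) [OF odd(2)]) (use s c k in presburger)+
    then have r': "idp_coeff w (n - 1) a b = q powi (s * (a + c)) * qbinom2_int k (c - 1)"
      by simp
    have n: "n + 1 = a + b + 2 * c + 1" "n = a + b + 2 * c" using c by auto
    have "qint (a + 1) * qbinom2_int (k + 1) c = qint (a + 1 + 2 * c) * qbinom2_int k c
        + qint (a + 1 + 2 * c - (s + 1)) * qbinom2_int k (c - 1)"
    proof -
      have "2 * (k + 1) = s + 1" using k by simp
      then show ?thesis using qbinom2_int_three_term_reflected [of "a + 1" k c] by (simp only:)
    qed
    note rec = recurrence_even_step_opposite_parity [OF this, of b]
    have "qint n = qint (a + b + 2 * c)" "qint (n + 1) = qint (a + b + 2 * c + 1)" using n by simp_all
    then show ?thesis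
      unfolding t_step_in_terms_of_s [OF s] e f g h r r' using rec by (simp only:)
  qed
qed

lemma idem_eq_expansion: "idem w = expansion w N (idp_coeff w 0)"
proof -
  have "idp_coeff w 0 (int a) (int b) *\<^sub>q pbw w a b =
      (if b = 0 then if a = 0 then idem w else 0 else 0)" for a b
  proof (cases "a = 0 \<and> b = 0")
    case True
    then show ?thesis
      by (simp add: idp_coeff_def pbw_def divE_def divF_def qfact_def qbinom2_int_def act_qscale_left)
  qed (auto simp: idp_coeff_eq_0)
  then show ?thesis by (simp add: expansion_def)
qed

lemma act_t_expansion_idp_coeff:
  assumes "n < N"
  shows "t \<rhd> expansion w N (idp_coeff w (int n)) = expansion w N (t_step w (idp_coeff w (int n)))"
  by (rule act_t_expansion) (use assms in \<open>auto intro!: idp_coeff_eq_0\<close>)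

text \<open>
  The bound \<open>N\<close> is arbitrary so that the powers with indices \<open>n\<close>, \<open>n + 1\<close> and \<open>n + 2\<close> can be expanded over
  the same square. At \<open>n = 0\<close> the term with index \<open>n - 1\<close> in the recursion has coefficient \<open>[0] = 0\<close>,
  so the first step follows the same pattern as the later ones.
\<close>
lemma t_odd_expansion:
  assumes w: "odd w" and "n \<le> N"
  shows "t_odd n \<rhd> idem w = expansion w N (idp_coeff w (int n))"
  using \<open>n \<le> N\<close>
proof (induction n rule: less_induct)
  case (less n)
  consider "n = 0" | "n = 1" | k where "n = Suc (Suc k)"
    by (metis One_nat_def not0_implies_Suc)
  then show ?case
  proof cases
    case 1
    then show ?thesis using idem_eq_expansion [of w N] by simp
  next
    case 2
    have "t_odd n \<rhd> idem w = t \<rhd> expansion w N (idp_coeff w (int 0))"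
      using 2 idem_eq_expansion [of w N] by simp
    also have "\<dots> = expansion w N (t_step w (idp_coeff w (int 0)))"
      by (rule act_t_expansion_idp_coeff) (use less.prems 2 in simp)
    also have "t_step w (idp_coeff w (int 0)) = idp_coeff w (int n)"
      using t_step_idp_coeff_even [of 0 w] w 2 by (intro ext) simp
    finally show ?thesis .
  next
    case (3 k)
    let ?X = "\<lambda>i. expansion w N (idp_coeff w (int i))"
    have n: "int n = int (Suc k) + 1" "int k = int (Suc k) - 1" "int k + 2 = int n"
      using 3 by simp_all
    have IH: "t_odd (Suc k) \<rhd> idem w = ?X (Suc k)" "t_odd k \<rhd> idem w = ?X k"
      using less 3 by simp_all
    have act_t: "t \<rhd> ?X (Suc k) = expansion w N (t_step w (idp_coeff w (int (Suc k))))"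
      by (rule act_t_expansion_idp_coeff) (use less.prems 3 in simp)
    show ?thesis
    proof (cases "even k")
      case True
      then have "t_step w (idp_coeff w (int (Suc k))) = (\<lambda>a b. qint (int n) * idp_coeff w (int n) a b)"
        unfolding n(1) using t_step_idp_coeff_odd [OF _ w] by (intro ext) simp
      then have "t \<rhd> ?X (Suc k) = qint (int n) *\<^sub>q ?X n"
        unfolding act_t by (simp only: expansion_qscale)
      moreover have "t_odd n \<rhd> idem w = inverse (qint (int n)) *\<^sub>q (t \<rhd> ?X (Suc k))"
        using True n(3) by (simp add: 3 act_qscale_left act_times IH add.commute)
      ultimately show ?thesis using 3 by (simp add: qscale_qscale qint_nonzero)
    next
      case False
      then have "t_step w (idp_coeff w (int (Suc k))) = (\<lambda>a b. qint (int n) * idp_coeff w (int n) a b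
          + qint (int (Suc k)) * idp_coeff w (int k) a b)"
        unfolding n(1,2) using t_step_idp_coeff_even [OF _ w] by (intro ext) simp
      then have "t \<rhd> ?X (Suc k) = qint (int n) *\<^sub>q ?X n + qint (int (Suc k)) *\<^sub>q ?X k"
        unfolding act_t by (simp only: expansion_qscale expansion_add)
      moreover have "t_odd n \<rhd> idem w =
          inverse (qint (int n)) *\<^sub>q (t \<rhd> ?X (Suc k) - qint (int (Suc k)) *\<^sub>q ?X k)"
        using False n(3) by (simp add: 3 act_qscale_left act_diff_left act_times IH add.commute)
      ultimately show ?thesis using 3 by (simp add: qscale_qscale qint_nonzero)
    qed
  qed
qed

section \<open>Integrality\<close>

lemma LaurentI: "finite S \<Longrightarrow> x = (\<Sum>k\<in>S. of_int (f k) * q powi k) \<Longrightarrow> x \<in> Laurent"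
  by (auto simp: Laurent_def)

lemma Laurent_powi: "q powi n \<in> Laurent"
  by (auto simp: Laurent_def intro!: exI [of _ "{n}"] exI [of _ "\<lambda>_. 1"])

lemma Laurent_0: "0 \<in> Laurent"
  by (auto simp: Laurent_def intro!: exI [of _ "{}"])

lemma Laurent_add:
  assumes "x \<in> Laurent" "y \<in> Laurent"
  shows "x + y \<in> Laurent"
proof -
  obtain S f T g where S: "finite S" "x = (\<Sum>k\<in>S. of_int (f k) * q powi k)"
    and T: "finite T" "y = (\<Sum>k\<in>T. of_int (g k) * q powi k)"
    using assms by (auto simp: Laurent_def)
  let ?h = "\<lambda>k. (if k \<in> S then f k else 0) + (if k \<in> T then g k else 0)"
  have "x = (\<Sum>k\<in>S \<union> T. of_int (if k \<in> S then f k else 0) * q powi k)"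
    unfolding S(2) by (rule sum.mono_neutral_cong_left) (use S T in auto)
  moreover have "y = (\<Sum>k\<in>S \<union> T. of_int (if k \<in> T then g k else 0) * q powi k)"
    unfolding T(2) by (rule sum.mono_neutral_cong_left) (use S T in auto)
  ultimately have "x + y = (\<Sum>k\<in>S \<union> T. of_int (?h k) * q powi k)"
    by (simp only: of_int_add distrib_right sum.distrib)
  with S(1) T(1) show ?thesis by (intro LaurentI [of "S \<union> T" _ ?h]) simp_all
qed

lemma Laurent_uminus: "x \<in> Laurent \<Longrightarrow> - x \<in> Laurent"
proof -
  assume "x \<in> Laurent"
  then obtain S f where S: "finite S" "x = (\<Sum>k\<in>S. of_int (f k) * q powi k)"
    by (auto simp: Laurent_def)
  then have "- x = (\<Sum>k\<in>S. of_int (- f k) * q powi k)" by (simp add: sum_negf)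
  with S(1) show ?thesis by (rule LaurentI)
qed

lemma Laurent_powi_mult: "x \<in> Laurent \<Longrightarrow> q powi n * x \<in> Laurent"
proof -
  assume "x \<in> Laurent"
  then obtain S f where S: "finite S" "x = (\<Sum>k\<in>S. of_int (f k) * q powi k)"
    by (auto simp: Laurent_def)
  have "q powi n * x = (\<Sum>k\<in>S. of_int (f k) * q powi (n + k))"
    unfolding S(2) by (simp add: sum_distrib_left power_int_add mult.left_commute)
  also have "\<dots> = (\<Sum>k\<in>(+) n ` S. of_int (f (k - n)) * q powi k)"
    by (simp add: sum.reindex)
  finally show ?thesis using S(1) by (intro LaurentI) simp_all
qed

text \<open>
  The Pascal rule expresses the binomial coefficients with upper entries \<open>k\<close> and \<open>k + 1\<close> by each other
  and by one with a smaller lower entry, with powers of \<open>q\<close> as factors. Hence one can go from \<open>k = 0\<close>,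
  where the value is \<open>0\<close> or \<open>1\<close>, up and down to all integers.
\<close>
lemma qbinom2_Laurent: "qbinom2 k c \<in> Laurent"
proof (induction c arbitrary: k)
  case 0
  show ?case using Laurent_powi [of 0] by simp
next
  case (Suc c)
  have pascal: "qbinom2 (k + 1) (Suc c) = q powi (- 2 * int (Suc c)) * qbinom2 k (Suc c)
     + q powi (2 * (k + 1) - 2 * int (Suc c)) * qbinom2 k c" for k
    using qbinom2_int_pascal [of k "int (Suc c)"] qbinom2_int_of_nat [of _ "Suc c"]
    by (simp add: qbinom2_int_def nat_add_distrib)
  show ?case
  proof (induction k rule: int_induct [where k = 0])
    case base
    have "qbinom2 0 (Suc c) = 0"
      unfolding qbinom2_def prod_zero_iff [OF finite_atLeastAtMost] by (rule bexI [of _ 1]) simp_all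
    then show ?case by (simp add: Laurent_0)
  next
    case (step1 k)
    then show ?case unfolding pascal by (intro Laurent_add Laurent_powi_mult Suc.IH)
  next
    case (step2 k)
    have cancel: "x = q powi (2 * d) * (q powi (- 2 * d) * x)" for d x
      by (simp flip: power_int_add mult.assoc)
    have "q powi (- 2 * int (Suc c)) * qbinom2 (k - 1) (Suc c) = qbinom2 k (Suc c)
       + - (q powi (2 * k - 2 * int (Suc c)) * qbinom2 (k - 1) c)"
      using pascal [of "k - 1"] by simp
    then have "qbinom2 (k - 1) (Suc c) = q powi (2 * int (Suc c)) * (qbinom2 k (Suc c)
       + - (q powi (2 * k - 2 * int (Suc c)) * qbinom2 (k - 1) c))"
      by (metis cancel)
    then show ?case using step2
      by (metis Laurent_add Laurent_powi_mult Laurent_uminus Suc.IH)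
  qed
qed

lemma idp_coeff_Laurent: "idp_coeff w n a b \<in> Laurent"
  by (auto simp: idp_coeff_def Let_def qbinom2_int_def Laurent_0
      intro!: Laurent_powi_mult qbinom2_Laurent)

text \<open>
  Inserting the idempotent of weight \<open>w - 2 b\<close> splits the element into a product of two generators.
\<close>
lemma pbw_Udot_A: "pbw w a b \<in> Udot_A"
proof -
  have "pbw w a b = (divE a \<rhd> idem (w - 2 * int b)) * (divF b \<rhd> idem w)"
    using has_weight_divF [of w b]
    by (simp add: pbw_def act_times has_weight_def flip: act_mult_right)
  then show ?thesis by (simp add: Udot_A.intros)
qed

lemma Udot_A_0: "0 \<in> Udot_A"
  using Udot_A.qscale [OF Laurent_0 Udot_A.idem [of 0]] by simp

lemma Udot_A_sum: "(\<And>i. i \<in> S \<Longrightarrow> f i \<in> Udot_A) \<Longrightarrow> sum f S \<in> Udot_A"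
  by (induction S rule: infinite_finite_induct) (simp_all add: Udot_A_0 Udot_A.add)

lemma t_odd_Udot_A_odd: "t_odd n \<rhd> idem (2 * l - 1) \<in> Udot_A_odd"
proof -
  let ?x = "t_odd n \<rhd> idem (2 * l - 1)"
  have "?x = expansion (2 * l - 1) n (idp_coeff (2 * l - 1) (int n))"
    by (rule t_odd_expansion) simp_all
  also have "\<dots> \<in> Udot_A"
    unfolding expansion_def
    by (intro Udot_A_sum Udot_A.qscale idp_coeff_Laurent pbw_Udot_A)
  finally have "?x \<in> Udot_A" .
  moreover have "?x = (\<Sum>k\<in>{l}. ?x * idem (2 * k - 1))"
    by (simp flip: act_mult_right)
  ultimately show ?thesis
    unfolding Udot_A_odd_def by (intro CollectI exI [of _ "{l}"] exI [of _ "\<lambda>_. ?x"]) simp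
qed

section \<open>The expansion as a sum over degrees\<close>

lemma sum_triangle:
  fixes g :: "nat \<Rightarrow> nat \<Rightarrow> 'a::comm_monoid_add"
  assumes "\<And>a b. n < a + b \<Longrightarrow> g a b = 0"
  shows "(\<Sum>a\<le>n. \<Sum>b\<le>n. g a b) = (\<Sum>k\<le>n. \<Sum>a\<le>k. g a (k - a))"
proof -
  have "(\<Sum>a\<le>n. \<Sum>b\<le>n. g a b) = (\<Sum>(a, b)\<in>{..n} \<times> {..n}. g a b)"
    by (rule sum.cartesian_product)
  also have "\<dots> = (\<Sum>(a, b)\<in>{(a, b). a + b \<le> n}. g a b)"
  proof (rule sum.mono_neutral_right)
    have "g a b = 0" if "\<not> a + b \<le> n" for a b
      using assms that by simp
    then show "\<forall>i\<in>{..n} \<times> {..n} - {(a, b). a + b \<le> n}. (case i of (a, b) \<Rightarrow> g a b) = 0"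
      by auto
  qed auto
  also have "\<dots> = (\<Sum>k\<le>n. \<Sum>a\<le>k. g a (k - a))"
    by (rule sum.triangle_reindex_eq)
  finally show ?thesis .
qed

lemma sum_split_parity:
  fixes h :: "nat \<Rightarrow> 'a::comm_monoid_add"
  shows "(\<Sum>k\<le>2 * m. h k) =
      (\<Sum>c=0..m. h (2 * m - 2 * c)) + (\<Sum>c\<in>{0..<m}. h (2 * m - 1 - 2 * c))" (is ?even)
    and "(\<Sum>k\<le>2 * m + 1. h k) =
      (\<Sum>c=0..m. h (2 * m + 1 - 2 * c)) + (\<Sum>c=0..m. h (2 * m - 2 * c))" (is ?odd)
proof -
  have split: "(\<Sum>k\<le>2 * m. h k) = (\<Sum>c=0..m. h (2 * c)) + (\<Sum>c=0..<m. h (2 * c + 1))"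
    by (induction m) (simp_all add: ac_simps)
  have 1: "(\<Sum>c=0..m. h (2 * c)) = (\<Sum>c=0..m. h (2 * m - 2 * c))"
    by (subst sum.atLeastAtMost_rev) (simp add: diff_mult_distrib2)
  have 2: "(\<Sum>c=0..m. h (2 * c + 1)) = (\<Sum>c=0..m. h (2 * m + 1 - 2 * c))"
    by (subst sum.atLeastAtMost_rev) (auto intro!: sum.cong arg_cong [where f = h])
  have 3: "(\<Sum>c=0..<m. h (2 * c + 1)) = (\<Sum>c\<in>{0..<m}. h (2 * m - 1 - 2 * c))"
    by (subst sum.atLeastLessThan_rev) (auto intro!: sum.cong arg_cong [where f = h])
  show ?even using split 1 3 by simp
  have "(\<Sum>k\<le>2 * m + 1. h k) = (\<Sum>c=0..m. h (2 * c + 1)) + (\<Sum>c=0..m. h (2 * c))"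
  proof -
    have "(\<Sum>c=0..m. h (2 * c + 1)) = (\<Sum>c=0..<m. h (2 * c + 1)) + h (2 * m + 1)"
      by (simp add: atLeast0LessThan atLeast0AtMost flip: lessThan_Suc_atMost)
    then show ?thesis
      unfolding Suc_eq_plus1 [symmetric] sum.atMost_Suc split by (simp only: ac_simps)
  qed
  then show ?odd unfolding 1 2 .
qed

lemma binom2_even: "binom2 (2 * c) = c * (2 * c - 1)"
  and binom2_odd: "binom2 (2 * c + 1) = c * (2 * c + 1)"
  by (simp_all add: binom2_def mult.commute mult.left_commute)

lemma t_odd_sum_by_degree:
  assumes "odd w"
  shows "t_odd n \<rhd> idem w =
    (\<Sum>k\<le>n. \<Sum>a=0..k. idp_coeff w (int n) (int a) (int (k - a)) *\<^sub>q
       ((divE a * divF (k - a)) \<rhd> idem w))"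
  unfolding t_odd_expansion [OF assms order_refl] expansion_def
  by (subst sum_triangle) (simp_all add: idp_coeff_eq_0 pbw_def atLeast0AtMost)

lemma odd_weight: "odd (2 * l - 1 :: int)"
  by simp

text \<open>
  The next four lemmas match the exponents and upper entries in the variables \<open>s\<close> and \<open>c\<close> with those in
  the variables \<open>m\<close>, \<open>l\<close>, \<open>a\<close> and \<open>c\<close>.
\<close>
lemma idp_coeff_even_same_parity:
  assumes "c \<le> m" "a \<le> 2 * m - 2 * c"
  shows "idp_coeff (2 * l - 1) (int (2 * m)) (int a) (int (2 * m - 2 * c - a)) =
    q powi (2 * (int a + int c) * (int m - int a - l) - 2 * int a * int c
       + int a - binom2 (2 * int c)) * qbinom2 (int m - int c - int a - l + 1) c"
proof -
  define s where "s = 2 * (int m - int c - int a - l) + 1"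
  have "s * (int a + int c) = 2 * (int a + int c) * (int m - int a - l) - 2 * int a * int c
       + int a - binom2 (2 * int c)"
    unfolding s_def binom2_even by (simp add: algebra_simps)
  moreover have "int (2 * m - 2 * c - a) = 2 * int m - 2 * int c - int a"
    using assms by (simp add: of_nat_diff)
  ultimately show ?thesis
    by (subst idp_coeff_even(1) [of _ _ _ _ s "int c" "int m - int c - int a - l + 1"])
      (simp_all add: s_def)
qed

lemma idp_coeff_even_opposite_parity:
  assumes "c < m" "a \<le> 2 * m - 1 - 2 * c"
  shows "idp_coeff (2 * l - 1) (int (2 * m)) (int a) (int (2 * m - 1 - 2 * c - a)) =
    q powi (2 * (int a + int c + 1) * (int m - int a - l) - 2 * int a * int c
       - binom2 (2 * int c + 2) + 1) * qbinom2 (int m - int c - int a - l) c"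
proof -
  define s where "s = 2 * (int m - int c - int a - l)"
  have "binom2 (2 * int c + 2) = (int c + 1) * (2 * int c + 1)"
    using binom2_even [of "int c + 1"] by simp
  then have "s * (int a + int c + 1) - int c = 2 * (int a + int c + 1) * (int m - int a - l)
       - 2 * int a * int c - binom2 (2 * int c + 2) + 1"
    unfolding s_def by (simp add: algebra_simps)
  moreover have "int (2 * m - 1 - 2 * c - a) = 2 * int m - 1 - 2 * int c - int a"
    using assms by (simp add: of_nat_diff)
  ultimately show ?thesis
    by (subst idp_coeff_even(2) [of _ _ _ _ s "int c" "int m - int c - int a - l"])
      (simp_all add: s_def)
qed

lemma idp_coeff_odd_same_parity:
  assumes "c \<le> m" "a \<le> 2 * m + 1 - 2 * c"
  shows "idp_coeff (2 * l - 1) (int (2 * m + 1)) (int a) (int (2 * m + 1 - 2 * c - a)) =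
    q powi (2 * (int a + int c) * (int m - int a - l) - 2 * int a * int c
       + 2 * int a - binom2 (2 * int c - 1) + 1) * qbinom2 (int m - int c - int a - l + 1) c"
proof -
  define s where "s = 2 * (int m - int c - int a - l + 1)"
  have "binom2 (2 * int c - 1) = (int c - 1) * (2 * int c - 1)"
    using binom2_odd [of "int c - 1"] by simp
  then have "s * (int a + int c) + int c = 2 * (int a + int c) * (int m - int a - l)
       - 2 * int a * int c + 2 * int a - binom2 (2 * int c - 1) + 1"
    unfolding s_def by (simp add: algebra_simps)
  moreover have "int (2 * m + 1 - 2 * c - a) = 2 * int m + 1 - 2 * int c - int a"
    using assms by (simp add: of_nat_diff)
  ultimately show ?thesis
    by (subst idp_coeff_odd(1) [of _ _ _ _ s "int c" "int m - int c - int a - l + 1"])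
      (simp_all add: s_def)
qed

lemma idp_coeff_odd_opposite_parity:
  assumes "c \<le> m" "a \<le> 2 * m - 2 * c"
  shows "idp_coeff (2 * l - 1) (int (2 * m + 1)) (int a) (int (2 * m - 2 * c - a)) =
    q powi (2 * (int a + int c + 1) * (int m - int a - l) - 2 * int a * int c
       + int a - binom2 (2 * int c + 1) + 1) * qbinom2 (int m - int c - int a - l) c"
proof -
  define s where "s = 2 * (int m - int c - int a - l) + 1"
  have "s * (int a + int c + 1) = 2 * (int a + int c + 1) * (int m - int a - l)
       - 2 * int a * int c + int a - binom2 (2 * int c + 1) + 1"
    unfolding s_def binom2_odd by (simp add: algebra_simps)
  moreover have "int (2 * m - 2 * c - a) = 2 * int m - 2 * int c - int a"
    using assms by (simp add: of_nat_diff)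
  ultimately show ?thesis
    by (subst idp_coeff_odd(2) [of _ _ _ _ s "int c" "int m - int c - int a - l"])
      (simp_all add: s_def)
qed

theorem proposition5p4:
  shows "(\<forall>(m::nat) (l::int).
      t_odd (2 * m) \<rhd> idem (2 * l - 1) =
        (\<Sum>c=0..m. \<Sum>a=0..2 * m - 2 * c.
           (q powi (2 * (int a + int c) * (int m - int a - l) - 2 * int a * int c
                      + int a - binom2 (2 * int c))
             * qbinom2 (int m - int c - int a - l + 1) c)
           *\<^sub>q ((divE a * divF (2 * m - 2 * c - a)) \<rhd> idem (2 * l - 1)))
        + (\<Sum>c\<in>{0..<m}. \<Sum>a=0..2 * m - 1 - 2 * c.
           (q powi (2 * (int a + int c + 1) * (int m - int a - l) - 2 * int a * int c
                      - binom2 (2 * int c + 2) + 1)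
             * qbinom2 (int m - int c - int a - l) c)
           *\<^sub>q ((divE a * divF (2 * m - 1 - 2 * c - a)) \<rhd> idem (2 * l - 1))))
    \<and> (\<forall>(m::nat) (l::int).
      t_odd (2 * m + 1) \<rhd> idem (2 * l - 1) =
        (\<Sum>c=0..m. \<Sum>a=0..2 * m + 1 - 2 * c.
           (q powi (2 * (int a + int c) * (int m - int a - l) - 2 * int a * int c
                      + 2 * int a - binom2 (2 * int c - 1) + 1)
             * qbinom2 (int m - int c - int a - l + 1) c)
           *\<^sub>q ((divE a * divF (2 * m + 1 - 2 * c - a)) \<rhd> idem (2 * l - 1)))
        + (\<Sum>c=0..m. \<Sum>a=0..2 * m - 2 * c.
           (q powi (2 * (int a + int c + 1) * (int m - int a - l) - 2 * int a * int c
                      + int a - binom2 (2 * int c + 1) + 1)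
             * qbinom2 (int m - int c - int a - l) c)
           *\<^sub>q ((divE a * divF (2 * m - 2 * c - a)) \<rhd> idem (2 * l - 1))))
    \<and> (\<forall>(n::nat) (l::int). t_odd n \<rhd> idem (2 * l - 1) \<in> Udot_A_odd)"
proof (intro conjI allI, goal_cases)
  case (1 m l)
  show ?case
    unfolding t_odd_sum_by_degree [OF odd_weight] sum_split_parity
    by (intro arg_cong2 [where f = "(+)"] sum.cong refl arg_cong2 [where f = qscale]
        idp_coeff_even_same_parity idp_coeff_even_opposite_parity) simp_all
next
  case (2 m l)
  show ?case
    unfolding t_odd_sum_by_degree [OF odd_weight] sum_split_parity
    by (intro arg_cong2 [where f = "(+)"] sum.cong refl arg_cong2 [where f = qscale]
        idp_coeff_odd_same_parity idp_coeff_odd_opposite_parity) simp_all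
next
  case (3 n l)
  show ?case by (rule t_odd_Udot_A_odd)
qed

end
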